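(* Let $n$ be a non-negative integer and let $F$ be the filter in the poset $I_{n}^{\bullet}$ of pointed integer partitions of $n$ generated by a pointed knapsack partition $\{\lambda,\underline{m}\}=\{\lambda_1,\dots,\lambda_p,\underline{m}\}$ of $n$. Let $\Pi_n^{\bullet}(F)=\{\pi\in\Pi_n^\bullet:\mathrm{type}(\pi)\in F\}$. Then $$\mu\left(\Pi_{n}^{\bullet}(F)\cup\{\hat{0}\}\right)=(-1)^{p-1}\cdot\sum_{\vec{c}\in V}\beta(\vec{c}),$$ that is, $(-1)^{p-1}$ times the number of permutations in $\mathfrak{S}_n$ whose descent composition belongs to $V$.
   Context: A pointed integer partition of $n$ is a pair $\{\lambda,\underline{m}\}=\{\lambda_1,\dots,\lambda_k,\underline{m}\}$ where $m\ge 0$ is an integer (the pointed part) and $\lambda$ is an integer partition (multiset of positive integers) of $n-m$. The poset $I_n^{\bullet}$ is ordered by the cover relations: replacing two non-pointed parts by their sum, and replacing a non-pointed part $\lambda_k$ and the pointed part $m$ by the pointed part $\lambda_k+m$ (going up). The filter generated by $x$ is $\{y:x\le y\}$. A multiset $\lambda=\{e_1^{m_1},\dots,e_q^{m_q}\}$ of positive integers (distinct $e_i$, multiplicities $m_i$) is a knapsack partition if the number of distinct integers $\sum_{e\in\mu}e$, $\mu$ a sub-multiset of $\lambda$, equals $\prod_{i=1}^q(m_i+1)$; equivalently each such sum has a unique representation as a sum of a sub-multiset of $\lambda$. $\{\lambda,\underline{m}\}$ is a pointed knapsack partition if $\lambda$ is a knapsack partition. A pointed set partition of $\{1,\dots,n\}$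 is a pair $(\sigma,Z)$ with $Z\subseteq\{1,\dots,n\}$ (zero block) and $\sigma$ a set partition of the complement of $Z$; $\Pi_n^\bullet$ is ordered by refinement (each block of $\pi$ lies in a block, possibly the zero block, of $\pi'$, and zero block of $\pi$ lies in zero block of $\pi'$). Its type is $\{\{|B|:B\in\sigma\},\underline{|Z|}\}$. For a poset $P$ with minimum $\hat0$ and maximum $\hat1$, $\mu(P)=\mu_P(\hat0,\hat1)$; here $\hat0$ is an adjoined minimum and $\hat1$ is the partition with all elements in the zero block. A pointed composition of $n$ is a list $\vec{c}=(c_1,\dots,c_{k-1},\underline{c_k})$ of non-negative integers summing to $n$ with $c_1,\dots,c_{k-1}>0$; its type is $\{c_1,\dots,c_{k-1},\underline{c_k}\}$, and $C_n^\bullet(F)$ is the set of pointed compositions with type in $F$. $\beta(\vec{c})$: if $c_k>0$, the number of permutations in $\mathfrak{S}_n$ with descent set exactly $\{c_1,c_1+c_2,\dots,c_1+\dots+c_{k-1}\}$; if $k\ge2$ and $c_k=0$, $\beta(\vec c)=0$; $\beta((\underline0))=1$. The descent composition of a permutation with descent set $\{s_1<\dots<s_{k-1}\}$ is $(s_1,s_2-s_1,\dots,n-s_{k-1})$. $V=V(\lambda,\underline{m})$ is the set of pointed compositions $\vec{c}=(c_1,\dots,c_{k-1},\underline{m})$ in $C_n^\bullet(F)$ (last entry exactly $m$) such that, when each $c_i$ ($1\le i\le k-1$) is expressed (uniquely) as a sum of parts of $\lambda$, the summands for each $c_i$ are distinct. *)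

theory Defs
  imports Complex_Main "HOL-Library.Multiset" "HOL-Library.Disjoint_Sets"
    "HOL-Combinatorics.Permutations"
begin

text \<open>Standard recursion mu(x,x) = 1, mu(x,y) = - sum over x <= z < y of mu(x,z),
  and mu(x,y) = 0 if not x <= y.  The recursion is unfolded with a fuel parameter;
  for a finite partial order on P the fuel card P + 1 is always sufficient, since a
  strict chain in P has at most card P elements.\<close>

fun mob_fuel :: "('a \<Rightarrow> 'a \<Rightarrow> bool) \<Rightarrow> 'a set \<Rightarrow> nat \<Rightarrow> 'a \<Rightarrow> 'a \<Rightarrow> int" where
  "mob_fuel le P 0 x y = 0"
| "mob_fuel le P (Suc k) x y =
     (if x = y then 1
      else if le x y then - (\<Sum>z\<in>{z\<in>P. le x z \<and> le z y \<and> z \<noteq> y}. mob_fuel le P k x z)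
      else 0)"

definition mobius :: "('a \<Rightarrow> 'a \<Rightarrow> bool) \<Rightarrow> 'a set \<Rightarrow> 'a \<Rightarrow> 'a \<Rightarrow> int" where
  "mobius le P x y = mob_fuel le P (card P + 1) x y"

text \<open>A pointed integer partition is a pair (lambda, m): lambda a multiset of positive
  naturals (the non-pointed parts), m the pointed part.\<close>

type_synonym ppart = "nat multiset \<times> nat"

definition pointed_partition :: "nat \<Rightarrow> ppart \<Rightarrow> bool" where
  "pointed_partition n x \<longleftrightarrow> 0 \<notin># fst x \<and> sum_mset (fst x) + snd x = n"

inductive I_cover :: "ppart \<Rightarrow> ppart \<Rightarrow> bool" where
  merge: "I_cover (add_mset a (add_mset b L), m) (add_mset (a + b) L, m)"
| absorb: "I_cover (add_mset a L, m) (L, a + m)"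

definition I_le :: "ppart \<Rightarrow> ppart \<Rightarrow> bool" where
  "I_le x y \<longleftrightarrow> I_cover\<^sup>*\<^sup>* x y"

definition I_filter :: "nat \<Rightarrow> ppart \<Rightarrow> ppart set" where
  "I_filter n x = {y. pointed_partition n y \<and> I_le x y}"

definition knapsack :: "nat multiset \<Rightarrow> bool" where
  "knapsack L \<longleftrightarrow>
     card {sum_mset \<mu> | \<mu>. \<mu> \<subseteq># L} = (\<Prod>e\<in>set_mset L. count L e + 1)"

type_synonym pspart = "nat set set \<times> nat set"

definition pointed_set_partitions :: "nat \<Rightarrow> pspart set" where
  "pointed_set_partitions n =
     {(\<sigma>, Z). Z \<subseteq> {1..n} \<and> partition_on ({1..n} - Z) \<sigma>}"

definition ps_le :: "pspart \<Rightarrow> pspart \<Rightarrow> bool" where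
  "ps_le p q \<longleftrightarrow>
     (\<forall>B\<in>fst p. (\<exists>B'\<in>fst q. B \<subseteq> B') \<or> B \<subseteq> snd q) \<and> snd p \<subseteq> snd q"

definition ps_type :: "pspart \<Rightarrow> ppart" where
  "ps_type p = (image_mset card (mset_set (fst p)), card (snd p))"

definition Pi_F :: "nat \<Rightarrow> ppart set \<Rightarrow> pspart set" where
  "Pi_F n F = {p \<in> pointed_set_partitions n. ps_type p \<in> F}"

definition hat_le :: "pspart option \<Rightarrow> pspart option \<Rightarrow> bool" where
  "hat_le a b = (case a of None \<Rightarrow> True
                 | Some x \<Rightarrow> (case b of None \<Rightarrow> False | Some y \<Rightarrow> ps_le x y))"

definition mu_Pi_F :: "nat \<Rightarrow> ppart set \<Rightarrow> int" where
  "mu_Pi_F n F = mobius hat_le (insert None (Some ` Pi_F n F)) None (Some ({}, {1..n}))"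

text \<open>A pointed composition (c_1,...,c_{k-1}, c_k pointed) is a nonempty list whose last
  entry is the pointed part.\<close>

definition pointed_composition :: "nat \<Rightarrow> nat list \<Rightarrow> bool" where
  "pointed_composition n c \<longleftrightarrow>
     c \<noteq> [] \<and> (\<forall>i < length c - 1. c ! i > 0) \<and> sum_list c = n"

definition pc_type :: "nat list \<Rightarrow> ppart" where
  "pc_type c = (mset (butlast c), last c)"

definition descents :: "nat \<Rightarrow> (nat \<Rightarrow> nat) \<Rightarrow> nat set" where
  "descents n p = {i \<in> {1..<n}. p i > p (Suc i)}"

definition partial_sums :: "nat list \<Rightarrow> nat set" where
  "partial_sums c = {sum_list (take j c) | j. 1 \<le> j \<and> j < length c}"

definition beta :: "nat list \<Rightarrow> nat" where
  "beta c =
     (if last c > 0 then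
        card {p. p permutes {1..sum_list c} \<and> descents (sum_list c) p = partial_sums c}
      else if length c \<ge> 2 then 0 else 1)"

definition descent_composition :: "nat \<Rightarrow> (nat \<Rightarrow> nat) \<Rightarrow> nat list" where
  "descent_composition n p =
     (let s = sorted_list_of_set (descents n p) in map2 (-) (s @ [n]) (0 # s))"

definition V :: "nat \<Rightarrow> nat multiset \<Rightarrow> nat \<Rightarrow> nat list set" where
  "V n L m = {c. pointed_composition n c \<and> pc_type c \<in> I_filter n (L, m) \<and> last c = m \<and>
     (\<forall>i < length c - 1. \<exists>\<mu>. \<mu> \<subseteq># L \<and> sum_mset \<mu> = c ! i \<and> (\<forall>e. count \<mu> e \<le> 1))}"

end

theory Submission
  imports Defs "HOL-Library.FuncSet"
begin

text \<open>
  Write \<open>\<mu>\<close> as minus the sum of \<open>\<mu>(z, 1)\<close> over the pointed set partitions \<open>z\<close> in the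
  filter. Up to sign, \<open>\<mu>(z, 1)\<close> counts the orderings of the non-zero blocks of \<open>z\<close>, so \<open>\<mu>\<close>
  becomes a signed count of lists of disjoint non-empty sets. The lists with prescribed block
  sizes are counted by the permutations whose descents are among the partial sums of
  the sizes. Exchanging the two sums leaves, for each permutation with descent set \<open>D\<close>, a signed
  sum over the compositions in the filter whose partial sums contain \<open>D\<close>. By the knapsack property
  these are flags of submultisets of \<open>\<lambda>\<close> refining a fixed one, and their signed sum is
  a product of Moebius functions of intervals of a product of chains: it is \<open>\<plusminus>1\<close> if the flag
  given by \<open>D\<close> ends at \<open>\<lambda>\<close> and all its steps are sets, and \<open>0\<close> otherwise.
\<close>

section \<open>Partial sums and submultisets\<close>

text \<open>Above a partition with \<open>k\<close> non-zero blocks lies a copy of the lattice of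
  partitions of \<open>k + 1\<close> objects, the zero block being one of them, and all of it stays
  in the filter; its Moebius number is \<open>(-1)^k * k!\<close>. This is the origin of the
  orderings. A list of blocks need not exhaust \<open>{1..n}\<close>: what is left is the zero
  block. So the sizes \<open>cs\<close> force the pointed part \<open>n - sum_list cs\<close>, and
  only lists of positive numbers remain. Absorption into the pointed part becomes the freedom of a
  flag to end at any submultiset of \<open>L\<close>.

  The obstacle is that descents constrain sums, while the filter speaks of multisets. The knapsack
  property enters as injectivity of \<open>sum_mset\<close> on submultisets: the sum of a member of
  a flag determines that member. Moebius values are not computed from intervals. In both places a
  closed form is written down and checked against the defining recursion: for set partitions the
  signed number of orderings, for multisets \<open>(-1) ^ size \<nu>\<close> if
  \<open>distinct_flag D \<nu>\<close> holds and 0 otherwise. Both checks are cancellations that add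
  or remove a single object.\<close>

primrec prefix_sums :: "nat list \<Rightarrow> nat set" where
  "prefix_sums [] = {}"
| "prefix_sums (c # cs) = insert c ((+) c ` prefix_sums cs)"

lemma prefix_sums_snoc: "prefix_sums (cs @ [c]) = insert (sum_list cs + c) (prefix_sums cs)"
  by (induction cs) (auto simp: algebra_simps image_iff)

lemma prefix_sums_le: "s \<in> prefix_sums cs \<Longrightarrow> s \<le> sum_list cs"
  by (induction cs arbitrary: s) auto

lemma prefix_sums_altdef: "prefix_sums cs = (\<lambda>j. sum_list (take j cs)) ` {1..length cs}"
proof (induction cs rule: rev_induct)
  case (snoc c cs)
  have "(\<lambda>j. sum_list (take j (cs @ [c]))) ` {1..length cs} = (\<lambda>j. sum_list (take j cs)) ` {1..length cs}"
    by (rule image_cong) auto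
  moreover have "{1..length (cs @ [c])} = insert (Suc (length cs)) {1..length cs}" by auto
  ultimately show ?case using snoc by (simp add: prefix_sums_snoc)
qed auto

text \<open>The pointed last entry never enters a partial sum, whereas \<open>prefix_sums\<close>
  includes the total of its list. This lets a pointed composition be treated as the list of its
  non-pointed parts.\<close>

lemma partial_sums_snoc: "partial_sums (cs @ [x]) = prefix_sums cs"
proof -
  have "partial_sums (cs @ [x]) = (\<lambda>j. sum_list (take j (cs @ [x]))) ` {1..length cs}"
    unfolding partial_sums_def by (auto simp del: take_append simp: image_iff less_Suc_eq_le Bex_def)
  also have "\<dots> = prefix_sums cs" unfolding prefix_sums_altdef by (rule image_cong) auto
  finally show ?thesis .
qed

section \<open>Submultisets, their number and their sums\<close>

lemma sum_mset_subset_mono: "\<mu> \<subseteq># \<nu> \<Longrightarrow> sum_mset \<mu> \<le> (sum_mset \<nu> :: nat)"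
  by (metis le_add1 subset_mset.add_diff_inverse sum_mset.union)

lemma finite_submultisets: "finite {\<mu>. \<mu> \<subseteq># L}"
proof -
  have "{\<mu>. \<mu> \<subseteq># L} \<subseteq> {\<mu>. set_mset \<mu> \<subseteq> set_mset L \<and> size \<mu> \<le> size L}"
    by (auto dest: mset_subset_eqD size_mset_mono)
  moreover have "{\<mu>. set_mset \<mu> \<subseteq> set_mset L \<and> size \<mu> \<le> size L}
      \<subseteq> mset ` {xs. set xs \<subseteq> set_mset L \<and> length xs \<le> size L}"
  proof safe
    fix \<mu> assume "set_mset \<mu> \<subseteq> set_mset L" "size \<mu> \<le> size L"
    moreover obtain xs where "mset xs = \<mu>" using ex_mset by blast
    ultimately show "\<mu> \<in> mset ` {xs. set xs \<subseteq> set_mset L \<and> length xs \<le> size L}" by auto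
  qed
  ultimately show ?thesis
    using finite_lists_length_le[of "set_mset L" "size L"] finite_surj finite_subset
    by (metis (no_types, lifting) finite_set_mset)
qed

text \<open>A submultiset amounts to an independent choice of a multiplicity at most
  \<open>count L e\<close> for each \<open>e\<close>, that is, to an element of a dependent
  product.\<close>

lemma card_submultisets: "card {\<mu>. \<mu> \<subseteq># L} = (\<Prod>e\<in>set_mset L. count L e + 1)"
proof -
  have "bij_betw (\<lambda>\<mu>. restrict (count \<mu>) (set_mset L)) {\<mu>. \<mu> \<subseteq># L}
          (PiE (set_mset L) (\<lambda>e. {0..count L e}))"
  proof (rule bij_betwI')
    fix x y assume *: "x \<in> {\<mu>. \<mu> \<subseteq># L}" "y \<in> {\<mu>. \<mu> \<subseteq># L}"
    show "(restrict (count x) (set_mset L) = restrict (count y) (set_mset L)) = (x = y)"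
    proof
      assume eq: "restrict (count x) (set_mset L) = restrict (count y) (set_mset L)"
      show "x = y"
      proof (rule multiset_eqI)
        fix e show "count x e = count y e"
        proof (cases "e \<in># L")
          case True thus ?thesis using fun_cong[OF eq, of e] by simp
        next
          case False thus ?thesis using * by (metis mem_Collect_eq mset_subset_eqD not_in_iff)
        qed
      qed
    qed simp
  next
    fix x assume "x \<in> {\<mu>. \<mu> \<subseteq># L}"
    thus "restrict (count x) (set_mset L) \<in> PiE (set_mset L) (\<lambda>e. {0..count L e})"
      by (auto simp: mset_subset_eq_count)
  next
    fix f assume f: "f \<in> PiE (set_mset L) (\<lambda>e. {0..count L e})"
    define x where "x = Abs_multiset (\<lambda>e. if e \<in># L then f e else 0)"
    have c: "count x e = (if e \<in># L then f e else 0)" for e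
      unfolding x_def by (subst count_Abs_multiset) auto
    have "x \<subseteq># L" using f by (auto simp: subseteq_mset_def c PiE_iff)
    moreover have "f = restrict (count x) (set_mset L)"
      using f by (auto simp: c PiE_iff extensional_def restrict_def)
    ultimately show "\<exists>x\<in>{\<mu>. \<mu> \<subseteq># L}. f = restrict (count x) (set_mset L)" by blast
  qed
  hence "card {\<mu>. \<mu> \<subseteq># L} = card (PiE (set_mset L) (\<lambda>e. {0..count L e}))"
    by (rule bij_betw_same_card)
  also have "\<dots> = (\<Prod>e\<in>set_mset L. count L e + 1)" by (simp add: card_PiE)
  finally show ?thesis .
qed

text \<open>By \<open>card_submultisets\<close>, \<open>knapsack\<close> says that
  \<open>sum_mset\<close> has as many values as there are submultisets; on a finite set this is
  injectivity.\<close>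

lemma knapsack_inj_on:
  assumes "knapsack L"
  shows "inj_on sum_mset {\<mu>. \<mu> \<subseteq># L}"
proof (rule eq_card_imp_inj_on)
  have "{sum_mset \<mu> | \<mu>. \<mu> \<subseteq># L} = sum_mset ` {\<mu>. \<mu> \<subseteq># L}" by auto
  thus "card (sum_mset ` {\<mu>. \<mu> \<subseteq># L}) = card {\<mu>. \<mu> \<subseteq># L}"
    using assms unfolding knapsack_def card_submultisets by simp
qed (rule finite_submultisets)

text \<open>In a product of chains the Moebius function is \<open>(-1) ^ size \<sigma>\<close> on
  sets and 0 on other multisets; this is its sum over a non-trivial interval. Toggling one fixed
  element \<open>a\<close> of \<delta> reverses the sign.\<close>

lemma alternating_sum_distinct_submultisets:
  fixes \<delta> :: "'a multiset"
  assumes "\<delta> \<noteq> {#}"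
  shows "(\<Sum>\<sigma> | \<sigma> \<subseteq># \<delta> \<and> (\<forall>e. count \<sigma> e \<le> 1). (-1) ^ size \<sigma>) = (0::int)" (is "sum ?f ?A = 0")
proof -
  obtain a where a: "a \<in># \<delta>" using assms by blast
  define t where "t \<sigma> = (if a \<in># \<sigma> then \<sigma> - {#a#} else add_mset a \<sigma>)" for \<sigma>
  have cnt: "count (t \<sigma>) e = (if e = a then 1 - count \<sigma> a else count \<sigma> e)"
    if "\<sigma> \<in> ?A" for \<sigma> e
  proof -
    have "count \<sigma> a \<le> 1" using that by auto
    thus ?thesis by (auto simp: t_def not_in_iff)
  qed
  have tA: "t \<sigma> \<in> ?A" if s: "\<sigma> \<in> ?A" for \<sigma>
  proof -
    have "count (t \<sigma>) e \<le> count \<delta> e \<and> count (t \<sigma>) e \<le> 1" for e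
    proof (cases "e = a")
      case True
      have "1 \<le> count \<delta> a" using a by (simp add: Suc_le_eq)
      moreover have "count (t \<sigma>) a = 1 - count \<sigma> a" using cnt[OF s] by simp
      ultimately show ?thesis unfolding True by (intro conjI; linarith)
    next
      case False
      thus ?thesis using s by (simp add: cnt[OF s] subseteq_mset_def)
    qed
    thus ?thesis by (simp add: subseteq_mset_def)
  qed
  have tt: "t (t \<sigma>) = \<sigma>" if s: "\<sigma> \<in> ?A" for \<sigma>
  proof (rule multiset_eqI)
    fix e have "count \<sigma> a \<le> 1" using s by auto
    thus "count (t (t \<sigma>)) e = count \<sigma> e" by (simp add: cnt[OF s] cnt[OF tA[OF s]])
  qed
  have sg: "?f (t \<sigma>) = - ?f \<sigma>" if "\<sigma> \<in> ?A" for \<sigma>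
  proof (cases "a \<in># \<sigma>")
    case True
    then obtain \<tau> where "\<sigma> = add_mset a \<tau>" by (metis multi_member_split)
    thus ?thesis by (simp add: t_def)
  qed (simp add: t_def)
  have "sum ?f ?A = (\<Sum>\<sigma>\<in>?A. - ?f \<sigma>)"
    by (rule sum.reindex_bij_witness[of _ t t]) (use tA tt sg in auto)
  thus ?thesis by (simp add: sum_negf)
qed

section \<open>Flags of submultisets\<close>

text \<open>Only the step sums of the flag are recorded, the flag itself being hidden. A step is
  asked to have positive sum, not just to be non-empty, so that the entries are positive for every
  multiset.\<close>

inductive piece_sums :: "nat list \<Rightarrow> nat multiset \<Rightarrow> bool" where
  piece_sums_Nil: "piece_sums [] {#}"
| piece_sums_snoc: "piece_sums cs \<rho> \<Longrightarrow> 0 < sum_mset \<delta> \<Longrightarrow> piece_sums (cs @ [sum_mset \<delta>]) (\<rho> + \<delta>)"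

lemma piece_sums_sum: "piece_sums cs \<nu> \<Longrightarrow> sum_list cs = sum_mset \<nu>"
  by (induction rule: piece_sums.induct) auto

lemma piece_sums_pos: "piece_sums cs \<nu> \<Longrightarrow> 0 \<notin> set cs"
  by (induction rule: piece_sums.induct) (auto simp del: sum_mset_0_iff)

lemma length_le_sum_list: "0 \<notin> set cs \<Longrightarrow> length cs \<le> sum_list (cs :: nat list)"
  by (induction cs) auto

lemma finite_pos_lists: "finite {cs :: nat list. 0 \<notin> set cs \<and> sum_list cs \<le> n}"
proof (rule finite_subset)
  show "{cs :: nat list. 0 \<notin> set cs \<and> sum_list cs \<le> n} \<subseteq> {cs. set cs \<subseteq> {..n} \<and> length cs \<le> n}"
    using length_le_sum_list member_le_sum_list by (auto intro: order_trans)
  show "finite {cs. set cs \<subseteq> {..n} \<and> length cs \<le> n}" by (rule finite_lists_length_le) simp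
qed

text \<open>The elements of \<open>D\<close> below \<open>sum_mset \<nu>\<close> are the sums of the proper members of a flag
  of multisets which ends at \<open>\<nu>\<close> and all of whose steps are sets.\<close>

inductive distinct_flag :: "nat set \<Rightarrow> nat multiset \<Rightarrow> bool" for D where
  distinct_flag_empty: "distinct_flag D {#}"
| distinct_flag_add: "distinct_flag D \<rho> \<Longrightarrow> \<delta> \<noteq> {#} \<Longrightarrow> (\<And>e. count \<delta> e \<le> 1) \<Longrightarrow>
    sum_mset \<rho> = 0 \<or> sum_mset \<rho> \<in> D \<Longrightarrow>
    (\<And>d. d \<in> D \<Longrightarrow> sum_mset \<rho> < d \<Longrightarrow> sum_mset \<rho> + sum_mset \<delta> \<le> d) \<Longrightarrow>
    distinct_flag D (\<rho> + \<delta>)"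

text \<open>The form in which the knapsack hypothesis is used: submultisets may be compared through
  their sums.\<close>

locale injective_subset_sums =
  fixes L :: "nat multiset"
  assumes inj: "inj_on sum_mset {\<mu>. \<mu> \<subseteq># L}"
begin

lemma sum_eqD: "\<mu> \<subseteq># L \<Longrightarrow> \<nu> \<subseteq># L \<Longrightarrow> sum_mset \<mu> = sum_mset \<nu> \<Longrightarrow> \<mu> = \<nu>"
  using inj by (auto dest: inj_onD)

text \<open>Injectivity, compared at \<open>{#}\<close>: no other submultiset of \<open>L\<close>
  has sum 0.\<close>

lemma sum_pos: "\<mu> \<subseteq># L \<Longrightarrow> \<mu> \<noteq> {#} \<Longrightarrow> 0 < sum_mset \<mu>"
  using sum_eqD[of \<mu> "{#}"] by (metis bot_nat_0.not_eq_extremum empty_le sum_mset.empty)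

text \<open>A flag counted here passes through some \<open>q\<close> whose sum is the largest element of \<open>D\<close>
  below \<open>sum_mset \<nu>\<close>, and makes at most one more step, by a set \<open>\<sigma> \<subseteq># \<nu> - q\<close>; since
  \<open>q \<noteq> \<nu>\<close>, the contributions of the \<open>\<sigma>\<close> cancel.\<close>

lemma alternating_sum_distinct_flags:
  assumes fD: "finite D" and \<nu>: "\<nu> \<subseteq># L" "\<nu> \<noteq> {#}"
  shows "(\<Sum>\<rho> | \<rho> \<subseteq># \<nu> \<and> distinct_flag D \<rho> \<and> (\<forall>d\<in>D. d < sum_mset \<nu> \<longrightarrow> d \<le> sum_mset \<rho>).
           (-1) ^ size \<rho>) = (0::int)" (is "sum ?f ?A = 0")
proof -
  \<comment> \<open>The element 0 stands for the start \<open>{#}\<close> of the flag, so that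
    \<open>t\<close> exists even if no element of \<open>D\<close> lies below
    \<open>sum_mset \<nu>\<close>.\<close>
  define E where "E = insert 0 {d \<in> D. d < sum_mset \<nu>}"
  define t where "t = Max E"
  have fE: "finite E" "E \<noteq> {}" using fD by (auto simp: E_def)
  have tE: "t \<in> E" using Max_in[OF fE] by (simp add: t_def)
  have tmax: "d \<le> t" if "d \<in> E" for d using Max_ge[OF fE(1) that] by (simp add: t_def)
  have t\<nu>: "t < sum_mset \<nu>" using tE sum_pos[OF \<nu>] by (auto simp: E_def)
  have tD: "t = 0 \<or> t \<in> D" using tE by (auto simp: E_def)
  have A: "?A = {\<rho>. \<rho> \<subseteq># \<nu> \<and> distinct_flag D \<rho> \<and> t \<le> sum_mset \<rho>}"
    using tE tmax by (auto simp: E_def intro: order_trans)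
  \<comment> \<open>If \<rho> ends beyond \<open>t\<close>, its last step starts exactly at
    \<open>t\<close>: a later start would contradict the maximality of \<open>t\<close>, and with an
    earlier one the element \<open>t\<close> of \<open>D\<close> would lie strictly inside the
    step.\<close>
  have flag: "\<exists>q \<sigma>. \<rho> = q + \<sigma> \<and> distinct_flag D q \<and> sum_mset q = t \<and> (\<forall>e. count \<sigma> e \<le> 1)"
    if \<rho>: "\<rho> \<subseteq># \<nu>" "distinct_flag D \<rho>" "t \<le> sum_mset \<rho>" for \<rho>
  proof (cases "sum_mset \<rho> = t")
    case True
    thus ?thesis using \<rho> by (intro exI[of _ \<rho>] exI[of _ "{#}"]) auto
  next
    case False
    hence lt: "t < sum_mset \<rho>" using \<rho> by simp
    from \<rho>(2) show ?thesis
    proof cases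
      case distinct_flag_empty thus ?thesis using lt by simp
    next
      case (distinct_flag_add q \<delta>)
      have "\<delta> \<subseteq># L" using distinct_flag_add(1) \<rho>(1) \<nu>(1)
        by (metis mset_subset_eq_add_right subset_mset.order_trans)
      hence "0 < sum_mset \<delta>" using distinct_flag_add(3) by (rule sum_pos)
      hence "sum_mset q < sum_mset \<rho>" using distinct_flag_add(1) by simp
      also have "\<dots> \<le> sum_mset \<nu>" using \<rho>(1) by (rule sum_mset_subset_mono)
      finally have "sum_mset q \<le> t" using tmax[of "sum_mset q"] distinct_flag_add(5) by (auto simp: E_def)
      moreover have "\<not> sum_mset q < t"
      proof
        assume less: "sum_mset q < t"
        hence "t \<in> D" using tD by simp
        thus False using distinct_flag_add(1) distinct_flag_add(6)[OF _ less] lt by simp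
      qed
      ultimately show ?thesis using distinct_flag_add by (intro exI[of _ q] exI[of _ \<delta>]) auto
    qed
  qed
  show ?thesis
  proof (cases "\<exists>q. q \<subseteq># \<nu> \<and> distinct_flag D q \<and> sum_mset q = t")
    case False
    have "?A = {}"
    proof (rule ccontr)
      assume "?A \<noteq> {}"
      then obtain \<rho> where \<rho>: "\<rho> \<subseteq># \<nu>" "distinct_flag D \<rho>" "t \<le> sum_mset \<rho>" unfolding A by blast
      with flag[OF this] False show False
        by (metis mset_subset_eq_add_left subset_mset.order_trans)
    qed
    thus ?thesis by (simp only: sum.empty)
  next
    case True
    then obtain q where q: "q \<subseteq># \<nu>" "distinct_flag D q" "sum_mset q = t" by blast
    define B where "B = {\<sigma>. \<sigma> \<subseteq># \<nu> - q \<and> (\<forall>e. count \<sigma> e \<le> 1)}"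
    have "?A = (+) q ` B"
    proof (intro equalityI subsetI)
      fix \<rho> assume "\<rho> \<in> ?A"
      hence \<rho>: "\<rho> \<subseteq># \<nu>" "distinct_flag D \<rho>" "t \<le> sum_mset \<rho>" unfolding A by auto
      then obtain q' \<sigma> where *: "\<rho> = q' + \<sigma>" "sum_mset q' = t" "\<forall>e. count \<sigma> e \<le> 1"
        using flag by blast
      hence "q' \<subseteq># \<nu>" using \<rho>(1) by (metis mset_subset_eq_add_left subset_mset.order_trans)
      \<comment> \<open>Injectivity of the sums: all flags in question pass through the same member
        at height \<open>t\<close>.\<close>
      hence "q' = q" using sum_eqD[of q' q] q * \<nu> by (auto intro: subset_mset.order_trans)
      thus "\<rho> \<in> (+) q ` B" using * \<rho>(1) q(1)
        by (auto simp: B_def subset_mset.le_diff_conv2 union_commute)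
    next
      fix \<rho> assume "\<rho> \<in> (+) q ` B"
      then obtain \<sigma> where \<sigma>: "\<rho> = q + \<sigma>" "\<sigma> \<subseteq># \<nu> - q" "\<forall>e. count \<sigma> e \<le> 1" by (auto simp: B_def)
      have \<rho>\<nu>: "\<rho> \<subseteq># \<nu>" using \<sigma> q(1) by (simp add: subset_mset.le_diff_conv2 union_commute)
      have "distinct_flag D \<rho>"
      proof (cases "\<sigma> = {#}")
        case False
        have "sum_mset q + sum_mset \<sigma> \<le> d" if "d \<in> D" "sum_mset q < d" for d
        proof -
          have "\<not> d < sum_mset \<nu>" using that tmax[of d] q(3) by (auto simp: E_def)
          thus ?thesis using sum_mset_subset_mono[OF \<rho>\<nu>] \<sigma>(1) by simp
        qed
        thus ?thesis unfolding \<sigma>(1) using False \<sigma> q tD by (intro distinct_flag_add) auto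
      qed (use \<sigma> q in simp)
      thus "\<rho> \<in> ?A" unfolding A using \<rho>\<nu> \<sigma> q by auto
    qed
    hence "sum ?f ?A = (\<Sum>\<sigma>\<in>B. ?f (q + \<sigma>))"
      by (simp add: sum.reindex inj_on_def)
    also have "\<dots> = (-1) ^ size q * (\<Sum>\<sigma>\<in>B. ?f \<sigma>)" by (simp add: power_add sum_distrib_left)
    also have "(\<Sum>\<sigma>\<in>B. ?f \<sigma>) = 0" unfolding B_def
    proof (rule alternating_sum_distinct_submultisets)
      show "\<nu> - q \<noteq> {#}" using t\<nu> q by (metis Diff_eq_empty_iff_mset less_irrefl subset_mset.antisym)
    qed
    finally show ?thesis by simp
  qed
qed

end

section \<open>Signed counts of compositions whose prefix sums contain a given set\<close>

lemma piece_sums_top: "piece_sums cs \<nu> \<Longrightarrow> sum_mset \<nu> = 0 \<or> sum_mset \<nu> \<in> prefix_sums cs"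
  by (erule piece_sums.cases) (auto simp: prefix_sums_snoc piece_sums_sum simp del: sum_mset_0_iff)

lemma piece_sums_empty_iff: "piece_sums cs {#} \<longleftrightarrow> cs = []"
  by (auto intro: piece_sums_Nil elim: piece_sums.cases)

lemma prefix_sums_pos: "0 \<notin> set cs \<Longrightarrow> 0 \<notin> prefix_sums cs"
  by (induction cs) auto

lemma finite_piece_sums: "finite {cs. piece_sums cs \<nu> \<and> P cs}"
  by (rule finite_subset[OF _ finite_pos_lists[of "sum_mset \<nu>"]])
    (auto simp: piece_sums_sum dest: piece_sums_pos)

text \<open>All steps of the flag end at or below \<open>t\<close>, so the new element interrupts
  none of them.\<close>

lemma distinct_flag_insert:
  "distinct_flag D \<rho> \<Longrightarrow> sum_mset \<rho> \<le> t \<Longrightarrow> distinct_flag (insert t D) \<rho>"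
proof (induction rule: distinct_flag.induct)
  case (distinct_flag_add \<rho> \<delta>)
  thus ?case by (intro distinct_flag.distinct_flag_add) auto
qed (rule distinct_flag_empty)

context injective_subset_sums
begin

text \<open>Deleting the last entry of a list flips the sign and leaves a list for a smaller \<rho>.
  The closed form obeys the same recursion by \<open>alternating_sum_distinct_flags\<close>.
  Elements of \<open>D\<close> at or above \<open>sum_mset \<nu>\<close> impose nothing, so
  \<open>D\<close> stays fixed during the induction.\<close>

lemma signed_piece_sums:
  assumes fD: "finite D" and D0: "0 \<notin> D" and "\<nu> \<subseteq># L"
  shows "(\<Sum>cs | piece_sums cs \<nu> \<and> (\<forall>d\<in>D. d < sum_mset \<nu> \<longrightarrow> d \<in> prefix_sums cs). (-1) ^ length cs)
       = (if distinct_flag D \<nu> then (-1) ^ size \<nu> else (0::int))"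
  using assms(3)
proof (induction "size \<nu>" arbitrary: \<nu> rule: less_induct)
  case (less \<nu>)
  define X where "X \<rho> = {cs. piece_sums cs \<rho> \<and> (\<forall>d\<in>D. d < sum_mset \<rho> \<longrightarrow> d \<in> prefix_sums cs)}" for \<rho>
  have finX: "finite (X \<rho>)" for \<rho> unfolding X_def by (rule finite_piece_sums)
  show ?case
  proof (cases "\<nu> = {#}")
    case True
    thus ?thesis by (simp add: piece_sums_empty_iff distinct_flag_empty cong: conj_cong)
  next
    case False
    \<comment> \<open>Possible last proper members of the flag: the step from \<rho> to \<nu> must
      not jump over an element of \<open>D\<close>.\<close>
    define A where "A = {\<rho>. \<rho> \<subset># \<nu> \<and> (\<forall>d\<in>D. d < sum_mset \<nu> \<longrightarrow> d \<le> sum_mset \<rho>)}"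
    have finA: "finite A"
      by (rule finite_subset[OF _ finite_submultisets[of \<nu>]]) (auto simp: A_def)
    have AL: "\<rho> \<subseteq># L" if "\<rho> \<in> A" for \<rho>
      using that less.prems by (auto simp: A_def intro: subset_mset.order_trans)
    have lt: "sum_mset \<rho> < sum_mset \<nu>" if "\<rho> \<in> A" for \<rho>
    proof -
      have "\<rho> \<subseteq># \<nu>" "\<rho> \<noteq> \<nu>" using that by (auto simp: A_def)
      thus ?thesis using sum_mset_subset_mono[of \<rho> \<nu>] sum_eqD[OF AL[OF that] less.prems] by force
    qed
    define g where "g = (\<lambda>(\<rho>, cs). cs @ [sum_mset \<nu> - sum_mset \<rho>])"
    have "bij_betw g (Sigma A X) (X \<nu>)"
      unfolding bij_betw_def
    proof (intro conjI)
      show "inj_on g (Sigma A X)"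
      proof (rule inj_onI; clarify)
        fix \<rho> cs \<rho>' cs' assume *: "\<rho> \<in> A" "\<rho>' \<in> A" "g (\<rho>, cs) = g (\<rho>', cs')"
        hence "sum_mset \<nu> - sum_mset \<rho> = sum_mset \<nu> - sum_mset \<rho>'" "cs = cs'" by (auto simp: g_def)
        moreover from this(1) have "sum_mset \<rho> = sum_mset \<rho>'" using lt[OF *(1)] lt[OF *(2)] by linarith
        ultimately show "\<rho> = \<rho>' \<and> cs = cs'" using sum_eqD[OF AL[OF *(1)] AL[OF *(2)]] by simp
      qed
      show "g ` Sigma A X = X \<nu>"
      proof (intro equalityI subsetI)
        fix c assume "c \<in> g ` Sigma A X"
        then obtain \<rho> cs where *: "\<rho> \<in> A" "cs \<in> X \<rho>" "c = cs @ [sum_mset \<nu> - sum_mset \<rho>]"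
          by (auto simp: g_def)
        define \<delta> where "\<delta> = \<nu> - \<rho>"
        have \<nu>: "\<nu> = \<rho> + \<delta>" using *(1) by (auto simp: A_def \<delta>_def)
        have ps: "piece_sums cs \<rho>" using *(2) by (simp add: X_def)
        have "piece_sums c \<nu>" unfolding *(3) using piece_sums_snoc[OF ps, of \<delta>] lt[OF *(1)] by (simp add: \<nu>)
        moreover have "d \<in> prefix_sums c" if "d \<in> D" "d < sum_mset \<nu>" for d
        proof -
          have "d \<le> sum_mset \<rho>" using that *(1) by (simp add: A_def)
          \<comment> \<open>Membership in \<open>X \<rho>\<close> is silent about
            \<open>d = sum_mset \<rho>\<close>; this \<open>d\<close> is the total of
            \<open>cs\<close>, a prefix sum because \<open>d\<close> is not 0.\<close>
          moreover have "d \<noteq> 0" using D0 that by metis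
          ultimately have "d \<in> prefix_sums cs"
            using *(2) that piece_sums_top[OF ps] by (cases "d = sum_mset \<rho>") (auto simp: X_def)
          thus ?thesis by (simp add: *(3) prefix_sums_snoc)
        qed
        ultimately show "c \<in> X \<nu>" by (simp add: X_def)
      next
        fix c assume c: "c \<in> X \<nu>"
        hence "piece_sums c \<nu>" by (simp add: X_def)
        thus "c \<in> g ` Sigma A X"
        proof cases
          case piece_sums_Nil thus ?thesis using False by simp
        next
          case (piece_sums_snoc cs \<rho> \<delta>)
          have D: "d \<in> prefix_sums cs" if "d \<in> D" "d < sum_mset \<nu>" for d
            using that c piece_sums_snoc piece_sums_sum[OF piece_sums_snoc(3)]
            by (auto simp: X_def prefix_sums_snoc)
          have "\<delta> \<noteq> {#}" using piece_sums_snoc(4) by auto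
          hence "\<rho> \<subset># \<nu>" using piece_sums_snoc(2) by (simp add: subset_mset.less_le)
          moreover have "d \<le> sum_mset \<rho>" if "d \<in> D" "d < sum_mset \<nu>" for d
            using prefix_sums_le[OF D[OF that]] piece_sums_sum[OF piece_sums_snoc(3)] by simp
          ultimately have "\<rho> \<in> A" by (simp add: A_def)
          moreover have "cs \<in> X \<rho>" using piece_sums_snoc D by (auto simp: X_def)
          moreover have "c = g (\<rho>, cs)" using piece_sums_snoc by (simp add: g_def)
          ultimately show ?thesis by blast
        qed
      qed
    qed
    hence "(\<Sum>cs\<in>X \<nu>. (-1::int) ^ length cs) = (\<Sum>y\<in>Sigma A X. (-1) ^ length (g y))"
      by (rule sum.reindex_bij_betw[symmetric])
    also have "\<dots> = (\<Sum>(\<rho>, cs)\<in>Sigma A X. - ((-1) ^ length cs))"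
      by (rule sum.cong) (auto simp: g_def)
    also have "\<dots> = (\<Sum>\<rho>\<in>A. \<Sum>cs\<in>X \<rho>. - ((-1) ^ length cs))"
      using finA finX by (subst sum.Sigma) auto
    also have "\<dots> = (\<Sum>\<rho>\<in>A. - (if distinct_flag D \<rho> then (-1) ^ size \<rho> else 0))"
    proof (rule sum.cong)
      fix \<rho> assume \<rho>: "\<rho> \<in> A"
      hence "size \<rho> < size \<nu>" by (auto simp: A_def intro: mset_subset_size)
      from less.hyps[OF this AL[OF \<rho>]]
      show "(\<Sum>cs\<in>X \<rho>. - ((-1) ^ length cs)) = - (if distinct_flag D \<rho> then (-1::int) ^ size \<rho> else 0)"
        by (simp add: X_def sum_negf)
    qed simp
    also have "\<dots> = - (\<Sum>\<rho>\<in>{\<rho>\<in>A. distinct_flag D \<rho>}. (-1) ^ size \<rho>)"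
      unfolding sum_negf sum.inter_filter[OF finA] ..
    also have "\<dots> = (if distinct_flag D \<nu> then (-1) ^ size \<nu> else 0)"
    proof -
      \<comment> \<open>The vanishing sum ranges over \<open>A\<close> and also over \<nu> itself;
        isolating the term of \<nu> gives the claim.\<close>
      let ?S = "{\<rho>. \<rho> \<subseteq># \<nu> \<and> distinct_flag D \<rho> \<and> (\<forall>d\<in>D. d < sum_mset \<nu> \<longrightarrow> d \<le> sum_mset \<rho>)}"
      have S: "?S = (if distinct_flag D \<nu> then insert \<nu> {\<rho>\<in>A. distinct_flag D \<rho>}
                else {\<rho>\<in>A. distinct_flag D \<rho>})"
        by (auto simp: A_def subset_mset.le_less)
      have "\<nu> \<notin> A" by (auto simp: A_def)
      thus ?thesis using alternating_sum_distinct_flags[OF fD less.prems False] finA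
        unfolding S by (auto split: if_splits)
    qed
    finally show ?thesis by (simp add: X_def)
  qed
qed

text \<open>Now the end \<nu> of the flag varies, the rest of \<open>L\<close> being absorbed by the
  pointed part. If \<open>sum_mset L \<in> D\<close>, only \<open>\<nu> = L\<close> can reach that
  height. Otherwise, for non-empty \<open>L\<close>, the closed forms cancel over all \<nu>, or no
  \<nu> reaches the top of \<open>D\<close>.\<close>

lemma signed_compositions:
  assumes fD: "finite D" and D0: "0 \<notin> D"
  shows "(\<Sum>cs | (\<exists>\<nu>. \<nu> \<subseteq># L \<and> piece_sums cs \<nu>) \<and> D \<subseteq> prefix_sums cs. (-1) ^ length cs)
       = (if distinct_flag D L \<and> (\<forall>d\<in>D. d \<le> sum_mset L) \<and> (L = {#} \<or> sum_mset L \<in> D)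
          then (-1) ^ size L else (0::int))"
proof -
  define X where "X \<rho> = {cs. piece_sums cs \<rho> \<and> (\<forall>d\<in>D. d < sum_mset \<rho> \<longrightarrow> d \<in> prefix_sums cs)}" for \<rho>
  define A where "A = {\<rho>. \<rho> \<subseteq># L \<and> (\<forall>d\<in>D. d \<le> sum_mset \<rho>)}"
  have finX: "finite (X \<rho>)" for \<rho> unfolding X_def by (rule finite_piece_sums)
  have finA: "finite A"
    by (rule finite_subset[OF _ finite_submultisets[of L]]) (auto simp: A_def)
  have iff: "D \<subseteq> prefix_sums cs \<longleftrightarrow> (\<forall>d\<in>D. d \<le> sum_mset \<nu>) \<and> cs \<in> X \<nu>" if ps: "piece_sums cs \<nu>" for cs \<nu>
  proof
    assume "D \<subseteq> prefix_sums cs"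
    thus "(\<forall>d\<in>D. d \<le> sum_mset \<nu>) \<and> cs \<in> X \<nu>"
      using ps prefix_sums_le[of _ cs] piece_sums_sum[OF ps] by (auto simp: X_def)
  next
    assume *: "(\<forall>d\<in>D. d \<le> sum_mset \<nu>) \<and> cs \<in> X \<nu>"
    show "D \<subseteq> prefix_sums cs"
    proof
      fix d assume d: "d \<in> D"
      have "d \<noteq> 0" using D0 d by metis
      thus "d \<in> prefix_sums cs" using * d piece_sums_top[OF ps] by (cases "d = sum_mset \<nu>") (auto simp: X_def)
    qed
  qed
  have "piece_sums cs \<nu>" if "cs \<in> X \<nu>" for cs \<nu> using that by (simp add: X_def)
  hence "{cs. (\<exists>\<nu>. \<nu> \<subseteq># L \<and> piece_sums cs \<nu>) \<and> D \<subseteq> prefix_sums cs} = (\<Union>\<nu>\<in>A. X \<nu>)"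
    unfolding A_def using iff by blast
  moreover have "(\<Sum>cs\<in>(\<Union>\<nu>\<in>A. X \<nu>). (-1::int) ^ length cs) = (\<Sum>\<nu>\<in>A. \<Sum>cs\<in>X \<nu>. (-1) ^ length cs)"
  proof (rule sum.UNION_disjoint)
    show "\<forall>\<nu>\<in>A. \<forall>\<nu>'\<in>A. \<nu> \<noteq> \<nu>' \<longrightarrow> X \<nu> \<inter> X \<nu>' = {}"
    proof (intro ballI impI, rule ccontr)
      fix \<nu> \<nu>' assume *: "\<nu> \<in> A" "\<nu>' \<in> A" "\<nu> \<noteq> \<nu>'" "X \<nu> \<inter> X \<nu>' \<noteq> {}"
      then obtain cs where "piece_sums cs \<nu>" "piece_sums cs \<nu>'" by (auto simp: X_def)
      hence "sum_mset \<nu> = sum_mset \<nu>'" by (metis piece_sums_sum)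
      thus False using * sum_eqD[of \<nu> \<nu>'] by (simp add: A_def)
    qed
  qed (use finA finX in auto)
  moreover have "(\<Sum>\<nu>\<in>A. \<Sum>cs\<in>X \<nu>. (-1::int) ^ length cs)
      = (\<Sum>\<nu>\<in>A. if distinct_flag D \<nu> then (-1) ^ size \<nu> else 0)"
    by (rule sum.cong) (auto simp: A_def X_def signed_piece_sums[OF fD D0])
  ultimately have eq: "(\<Sum>cs | (\<exists>\<nu>. \<nu> \<subseteq># L \<and> piece_sums cs \<nu>) \<and> D \<subseteq> prefix_sums cs. (-1::int) ^ length cs)
      = (\<Sum>\<nu>\<in>A. if distinct_flag D \<nu> then (-1) ^ size \<nu> else 0)" by simp
  show ?thesis
  proof (cases "L = {#} \<or> sum_mset L \<in> D")
    case True
    have "A = (if \<forall>d\<in>D. d \<le> sum_mset L then {L} else {})"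
    proof -
      have "\<rho> = L" if "\<rho> \<in> A" for \<rho>
      proof (cases "L = {#}")
        case True thus ?thesis using that by (simp add: A_def)
      next
        case False
        hence "sum_mset L \<le> sum_mset \<rho>" using that True by (auto simp: A_def)
        hence "sum_mset L = sum_mset \<rho>" using sum_mset_subset_mono[of \<rho> L] that by (simp add: A_def)
        thus ?thesis using that by (intro sum_eqD) (simp_all add: A_def)
      qed
      hence "A \<subseteq> {L}" by blast
      moreover have "L \<in> A \<longleftrightarrow> (\<forall>d\<in>D. d \<le> sum_mset L)" by (simp add: A_def)
      ultimately show ?thesis by auto
    qed
    thus ?thesis unfolding eq using True by auto
  next
    case False
    show ?thesis
    proof (cases "\<forall>d\<in>D. d \<le> sum_mset L")
      case True
      \<comment> \<open>As \<open>sum_mset L\<close> is not in \<open>D\<close>, every element of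
        \<open>D\<close> is strictly smaller, and the set is the index set of
        \<open>alternating_sum_distinct_flags\<close> with \<open>L\<close> as top.\<close>
      have "{\<rho>\<in>A. distinct_flag D \<rho>} = {\<rho>. \<rho> \<subseteq># L \<and> distinct_flag D \<rho> \<and>
          (\<forall>d\<in>D. d < sum_mset L \<longrightarrow> d \<le> sum_mset \<rho>)}"
      proof -
        have "d < sum_mset L" if "d \<in> D" for d
          using True False that by (metis le_neq_implies_less)
        thus ?thesis by (auto simp: A_def)
      qed
      thus ?thesis unfolding eq sum.inter_filter[OF finA, symmetric]
        using alternating_sum_distinct_flags[OF fD, of L] False by simp
    next
      case not_le: False
      then obtain d where d: "d \<in> D" "\<not> d \<le> sum_mset L" by blast
      have "\<rho> \<notin> A" for \<rho>
      proof
        assume "\<rho> \<in> A"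
        hence "d \<le> sum_mset \<rho>" "sum_mset \<rho> \<le> sum_mset L"
          using d(1) sum_mset_subset_mono[of \<rho> L] by (simp_all add: A_def)
        thus False using d(2) by simp
      qed
      hence "A = {}" by blast
      thus ?thesis unfolding eq using False by auto
    qed
  qed
qed

text \<open>The last assumption, taken from \<open>V\<close>, concerns the entries alone.
  Injectivity identifies its \<mu> with the step \<delta> of the flag, so the steps themselves are
  sets.\<close>

lemma piece_sums_distinct_flag:
  assumes "piece_sums cs \<nu>" "\<nu> \<subseteq># L"
    "\<forall>c\<in>set cs. \<exists>\<mu>. \<mu> \<subseteq># L \<and> sum_mset \<mu> = c \<and> (\<forall>e. count \<mu> e \<le> 1)"
  shows "distinct_flag (prefix_sums cs) \<nu>"
  using assms
proof (induction rule: piece_sums.induct)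
  case (piece_sums_snoc cs \<rho> \<delta>)
  let ?t = "sum_list cs + sum_mset \<delta>"
  have \<rho>: "\<rho> \<subseteq># L" and \<delta>: "\<delta> \<subseteq># L"
    using piece_sums_snoc.prems(1)
    by (metis mset_subset_eq_add_left subset_mset.order_trans,
        metis mset_subset_eq_add_right subset_mset.order_trans)
  obtain \<mu> where "\<mu> \<subseteq># L" "sum_mset \<mu> = sum_mset \<delta>" "\<forall>e. count \<mu> e \<le> 1"
    using piece_sums_snoc.prems(2) by auto
  hence set: "count \<delta> e \<le> 1" for e using sum_eqD[OF _ \<delta>] by auto
  have s: "sum_list cs = sum_mset \<rho>" using piece_sums_snoc.hyps(1) by (rule piece_sums_sum)
  have "distinct_flag (insert ?t (prefix_sums cs)) \<rho>"
    by (rule distinct_flag_insert) (use piece_sums_snoc.IH[OF \<rho>] piece_sums_snoc.prems s in auto)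
  hence "distinct_flag (insert ?t (prefix_sums cs)) (\<rho> + \<delta>)"
  proof (rule distinct_flag_add[OF _ _ set])
    show "\<delta> \<noteq> {#}" using piece_sums_snoc.hyps(2) by auto
    show "sum_mset \<rho> = 0 \<or> sum_mset \<rho> \<in> insert ?t (prefix_sums cs)"
      using piece_sums_top[OF piece_sums_snoc.hyps(1)] by auto
    show "sum_mset \<rho> + sum_mset \<delta> \<le> d" if "d \<in> insert ?t (prefix_sums cs)" "sum_mset \<rho> < d" for d
      using that prefix_sums_le[of d cs] s by auto
  qed
  thus ?case by (simp add: prefix_sums_snoc)
qed (simp add: distinct_flag_empty)

text \<open>The list consists of the step sums of the flag. Its prefix sums exhaust \<open>D\<close>
  up to the end of the flag because no element of \<open>D\<close> lies strictly inside a
  step.\<close>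

lemma distinct_flag_piece_sums:
  assumes "distinct_flag D \<nu>" "\<nu> \<subseteq># L" "sum_mset \<nu> = 0 \<or> sum_mset \<nu> \<in> D" "0 \<notin> D"
  shows "\<exists>cs. piece_sums cs \<nu> \<and> prefix_sums cs = {d\<in>D. d \<le> sum_mset \<nu>} \<and>
    (\<forall>c\<in>set cs. \<exists>\<mu>. \<mu> \<subseteq># L \<and> sum_mset \<mu> = c \<and> (\<forall>e. count \<mu> e \<le> 1))"
  using assms
proof (induction rule: distinct_flag.induct)
  case distinct_flag_empty
  thus ?case by (intro exI[of _ "[]"]) (auto intro: piece_sums_Nil)
next
  case (distinct_flag_add \<rho> \<delta>)
  have \<rho>: "\<rho> \<subseteq># L" and \<delta>: "\<delta> \<subseteq># L"
    using distinct_flag_add.prems(1)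
    by (metis mset_subset_eq_add_left subset_mset.order_trans,
        metis mset_subset_eq_add_right subset_mset.order_trans)
  have d0: "0 < sum_mset \<delta>" using \<delta> distinct_flag_add.hyps(2) by (rule sum_pos)
  obtain cs where cs: "piece_sums cs \<rho>" "prefix_sums cs = {d\<in>D. d \<le> sum_mset \<rho>}"
    "\<forall>c\<in>set cs. \<exists>\<mu>. \<mu> \<subseteq># L \<and> sum_mset \<mu> = c \<and> (\<forall>e. count \<mu> e \<le> 1)"
    using distinct_flag_add.IH[OF \<rho> distinct_flag_add.hyps(4) distinct_flag_add.prems(3)] by blast
  have inD: "sum_mset \<rho> + sum_mset \<delta> \<in> D" using distinct_flag_add.prems(2) d0 by (simp del: sum_mset_0_iff)
  have "prefix_sums (cs @ [sum_mset \<delta>]) = {d\<in>D. d \<le> sum_mset (\<rho> + \<delta>)}"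
    using distinct_flag_add.hyps(5) inD cs(2) piece_sums_sum[OF cs(1)]
    by (force simp: prefix_sums_snoc not_less)
  moreover have "piece_sums (cs @ [sum_mset \<delta>]) (\<rho> + \<delta>)" using cs(1) d0 by (rule piece_sums_snoc)
  moreover have "\<exists>\<mu>. \<mu> \<subseteq># L \<and> sum_mset \<mu> = sum_mset \<delta> \<and> (\<forall>e. count \<mu> e \<le> 1)"
    using \<delta> distinct_flag_add.hyps(3) by blast
  ultimately show ?case using cs(3) by (intro exI[of _ "cs @ [sum_mset \<delta>]"]) auto
qed

end

section \<open>Filters of pointed integer partitions\<close>

lemma I_le_trans: "I_le x y \<Longrightarrow> I_le y z \<Longrightarrow> I_le x z"
  unfolding I_le_def by simp

lemma I_le_merge: "M \<noteq> {#} \<Longrightarrow> I_le (M + K, m) (add_mset (sum_mset M) K, m)"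
proof (induction M arbitrary: K)
  case (add a M)
  show ?case
  proof (cases "M = {#}")
    case True thus ?thesis by (simp add: I_le_def)
  next
    case False
    have "I_le (add_mset a M + K, m) (add_mset (sum_mset M) (add_mset a K), m)"
      using add.IH[OF False, of "add_mset a K"] by simp
    moreover have "I_cover (add_mset (sum_mset M) (add_mset a K), m) (add_mset (sum_mset M + a) K, m)"
      by (rule merge)
    ultimately show ?thesis unfolding I_le_def by (simp add: add.commute)
  qed
qed simp

lemma I_le_absorb: "I_le (N + R, m) (N, m + sum_mset R)"
proof (induction R arbitrary: m)
  case (add a R)
  have "I_cover (N + add_mset a R, m) (N + R, a + m)" using absorb[of a "N + R" m] by simp
  moreover have "I_le (N + R, a + m) (N, a + m + sum_mset R)" by (rule add.IH)
  ultimately show ?case unfolding I_le_def by (simp add: ac_simps converse_rtranclp_into_rtranclp)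
qed (simp add: I_le_def)

text \<open>\<open>R\<close> holds the parts not yet merged; it is arbitrary because in the
  induction the last step \<delta> belongs to it.\<close>

lemma piece_sums_I_le: "piece_sums cs \<rho> \<Longrightarrow> I_le (\<rho> + R, m) (mset cs + R, m)"
proof (induction arbitrary: R rule: piece_sums.induct)
  case (piece_sums_snoc cs \<rho> \<delta>)
  have "I_le (\<rho> + \<delta> + R, m) (mset cs + (\<delta> + R), m)"
    using piece_sums_snoc.IH[of "\<delta> + R"] by (simp add: ac_simps)
  moreover have "I_le (\<delta> + (mset cs + R), m) (add_mset (sum_mset \<delta>) (mset cs + R), m)"
    using piece_sums_snoc.hyps(2) by (intro I_le_merge) auto
  ultimately show ?case using I_le_trans by (simp add: ac_simps)
qed (simp add: I_le_def)

text \<open>An invariant of upward chains, starting from singletons: \<open>M\<close> groups the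
  parts of \<open>L\<close> by the part they have been merged into, \<open>R\<close> collects the
  absorbed ones. Merging unites two groups, absorbing moves a group to \<open>R\<close>.\<close>

lemma I_le_decomposition:
  assumes "I_le (L, m) y"
  shows "\<exists>M R. L = sum_mset M + R \<and> fst y = image_mset sum_mset M \<and> snd y = m + sum_mset R"
  using assms unfolding I_le_def
proof (induction rule: rtranclp_induct)
  case base
  have "image_mset sum_mset (image_mset (\<lambda>a. {#a#}) L) = L" "sum_mset (image_mset (\<lambda>a. {#a#}) L) = L"
    by (induction L) auto
  thus ?case by (intro exI[of _ "image_mset (\<lambda>a. {#a#}) L"] exI[of _ "{#}"]) simp
next
  case (step y z)
  then obtain M R where MR: "L = sum_mset M + R" "fst y = image_mset sum_mset M" "snd y = m + sum_mset R"
    by blast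
  from step.hyps(2) show ?case
  proof cases
    case (merge a b K k)
    then obtain A M' where A: "M = add_mset A M'" "sum_mset A = a" "image_mset sum_mset M' = add_mset b K"
      using MR(2) by (metis fst_conv msed_map_invR)
    then obtain B M'' where B: "M' = add_mset B M''" "sum_mset B = b" "image_mset sum_mset M'' = K"
      by (metis msed_map_invR)
    show ?thesis using merge MR A B
      by (intro exI[of _ "add_mset (A + B) M''"] exI[of _ R]) (auto simp: ac_simps)
  next
    case (absorb a K k)
    then obtain A M' where "M = add_mset A M'" "sum_mset A = a" "image_mset sum_mset M' = K"
      using MR(2) by (metis fst_conv msed_map_invR)
    thus ?thesis using absorb MR
      by (intro exI[of _ M'] exI[of _ "A + R"]) (auto simp: ac_simps)
  qed
qed

lemma piece_sums_sum_mset: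
  "mset cs = image_mset sum_mset M \<Longrightarrow> 0 \<notin> set cs \<Longrightarrow> piece_sums cs (sum_mset M)"
proof (induction cs arbitrary: M rule: rev_induct)
  case (snoc c cs)
  hence "image_mset sum_mset M = add_mset c (mset cs)" by simp
  then obtain A M' where A: "M = add_mset A M'" "sum_mset A = c" "image_mset sum_mset M' = mset cs"
    by (metis msed_map_invR)
  have "piece_sums cs (sum_mset M')" using snoc.IH[of M'] A(3) snoc.prems(2) by simp
  moreover have "0 < sum_mset A" using A(2) snoc.prems(2) by auto
  ultimately have "piece_sums (cs @ [sum_mset A]) (sum_mset M' + A)" by (rule piece_sums_snoc)
  thus ?case using A by (simp add: ac_simps)
qed (simp add: piece_sums_Nil)

text \<open>Upwards, merge along the flag and then absorb \<open>L - \<nu>\<close>; the total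
  \<open>n\<close> forces the resulting pointed part. Conversely, \<nu> is the union of the groups
  given by \<open>I_le_decomposition\<close>.\<close>

lemma mem_I_filter_iff:
  assumes "pointed_partition n (L, m)" "0 \<notin> set cs" "sum_list cs \<le> n"
  shows "(mset cs, n - sum_list cs) \<in> I_filter n (L, m) \<longleftrightarrow> (\<exists>\<nu>. \<nu> \<subseteq># L \<and> piece_sums cs \<nu>)"
proof
  assume "(mset cs, n - sum_list cs) \<in> I_filter n (L, m)"
  hence "I_le (L, m) (mset cs, n - sum_list cs)" by (simp add: I_filter_def)
  from I_le_decomposition[OF this] obtain M R where "L = sum_mset M + R" "mset cs = image_mset sum_mset M"
    by auto
  moreover from this(2) assms(2) have "piece_sums cs (sum_mset M)" by (rule piece_sums_sum_mset)
  ultimately show "\<exists>\<nu>. \<nu> \<subseteq># L \<and> piece_sums cs \<nu>" using mset_subset_eq_add_left by blast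
next
  assume "\<exists>\<nu>. \<nu> \<subseteq># L \<and> piece_sums cs \<nu>"
  then obtain \<nu> R where \<nu>: "L = \<nu> + R" "piece_sums cs \<nu>"
    by (metis subset_mset.add_diff_inverse)
  have "I_le (\<nu> + R, m) (mset cs + R, m)" using \<nu>(2) by (rule piece_sums_I_le)
  hence "I_le (L, m) (mset cs, m + sum_mset R)" unfolding \<nu>(1) using I_le_absorb by (rule I_le_trans)
  moreover have "m + sum_mset R = n - sum_list cs"
    using assms(1) \<nu>(1) piece_sums_sum[OF \<nu>(2)] by (auto simp: pointed_partition_def)
  ultimately show "(mset cs, n - sum_list cs) \<in> I_filter n (L, m)"
    using assms(2,3) by (simp add: I_filter_def pointed_partition_def sum_mset_sum_list)
qed

section \<open>Descent compositions\<close>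

text \<open>The least prefix sum is the first entry; remove it and shift the others back.\<close>

lemma prefix_sums_inj:
  "0 \<notin> set cs \<Longrightarrow> 0 \<notin> set cs' \<Longrightarrow> prefix_sums cs = prefix_sums cs' \<Longrightarrow> cs = cs'"
proof (induction cs arbitrary: cs')
  case Nil thus ?case by (cases cs') auto
next
  case (Cons c cs)
  then obtain c' ds where cs': "cs' = c' # ds" by (cases cs') auto
  have least: "a \<le> x" if "x \<in> prefix_sums (a # as)" for a x as using that by auto
  have "c \<le> c'" by (rule least[of _ _ cs]) (simp only: Cons.prems(3) cs', simp)
  moreover have "c' \<le> c" by (rule least[of _ _ ds]) (simp only: Cons.prems(3)[symmetric] cs'[symmetric], simp)
  ultimately have c: "c = c'" by simp
  \<comment> \<open>Positivity keeps \<open>c\<close> out of the shifted sets, so that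
    \<open>insert c\<close> can be cancelled.\<close>
  have "0 \<notin> prefix_sums cs" "0 \<notin> prefix_sums ds"
    using Cons.prems cs' by (auto intro!: prefix_sums_pos)
  hence "c \<notin> (+) c ` prefix_sums cs" "c \<notin> (+) c ` prefix_sums ds" by auto
  hence "(+) c ` prefix_sums cs = (+) c ` prefix_sums ds"
    using Cons.prems(3) cs' c by (simp add: insert_ident)
  hence "prefix_sums cs = prefix_sums ds" by (simp add: inj_image_eq_iff)
  thus ?case using Cons cs' c by auto
qed

text \<open>The start \<open>a\<close> is arbitrary because the induction moves it along the list;
  descent compositions are the case \<open>a = 0\<close>.\<close>

lemma sorted_list_gaps:
  assumes "sorted_wrt (<) (a # s)" "\<forall>x\<in>set (a # s). x \<le> n"
  shows "\<exists>cs. map2 (-) (s @ [n]) (a # s) = cs @ [n - a - sum_list cs] \<and>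
           (+) a ` prefix_sums cs = set s \<and> 0 \<notin> set cs \<and> a + sum_list cs \<le> (n::nat)"
  using assms
proof (induction s arbitrary: a)
  case Nil thus ?case by (intro exI[of _ "[]"]) auto
next
  case (Cons b s)
  have "sorted_wrt (<) (b # s)" "\<forall>x\<in>set (b # s). x \<le> n" using Cons.prems by simp_all
  from Cons.IH[OF this] obtain cs where cs: "map2 (-) (s @ [n]) (b # s) = cs @ [n - b - sum_list cs]"
    "(+) b ` prefix_sums cs = set s" "0 \<notin> set cs" "b + sum_list cs \<le> n" by blast
  have ab: "a < b" using Cons.prems by simp
  have "(+) a ` (+) (b - a) ` prefix_sums cs = (+) b ` prefix_sums cs"
    using ab by (auto simp: image_image)
  thus ?case using cs ab by (intro exI[of _ "(b - a) # cs"]) auto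
qed

lemma descent_compositionE:
  obtains cs where "descent_composition n p = cs @ [n - sum_list cs]"
    "prefix_sums cs = descents n p" "0 \<notin> set cs" "sum_list cs \<le> n"
proof -
  let ?s = "sorted_list_of_set (descents n p)"
  have fin: "finite (descents n p)" by (simp add: descents_def)
  have D: "descents n p \<subseteq> {1..<n}" by (auto simp: descents_def)
  have "sorted_wrt (<) (0 # ?s)" "\<forall>x\<in>set (0 # ?s). x \<le> n"
    using fin D by (auto simp: strict_sorted_iff[symmetric])
  from sorted_list_gaps[OF this] fin show ?thesis using that
    by (auto simp: descent_composition_def Let_def)
qed

lemma mem_V_E:
  assumes "c \<in> V n L m"
  obtains cs where "c = cs @ [m]" "0 \<notin> set cs" "sum_list cs + m = n"
proof
  have c: "pointed_composition n c" "last c = m" using assms by (auto simp: V_def)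
  hence ne: "c \<noteq> []" by (simp add: pointed_composition_def)
  show cm: "c = butlast c @ [m]" using ne c(2) by (metis append_butlast_last_id)
  have "\<forall>i<length (butlast c). butlast c ! i > 0" using c(1) by (simp add: pointed_composition_def nth_butlast)
  thus "0 \<notin> set (butlast c)" by (metis in_set_conv_nth less_irrefl)
  have "sum_list c = n" using c(1) by (simp add: pointed_composition_def)
  thus "sum_list (butlast c) + m = n" using cm by (metis add.right_neutral sum_list.Cons sum_list.Nil sum_list_append)
qed

lemma finite_V: "finite (V n L m)"
proof (rule finite_subset)
  show "V n L m \<subseteq> (\<lambda>cs. cs @ [m]) ` {cs. 0 \<notin> set cs \<and> sum_list cs \<le> n}"
    by (auto elim!: mem_V_E)
qed (simp add: finite_pos_lists)

text \<open>Descents are smaller than \<open>n\<close>, so for \<open>n > 0\<close> a descent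
  composition ends in a positive entry. Hence for \<open>m = 0 < n\<close> both sides vanish, the
  left one by the convention in \<open>beta\<close>; for \<open>n = 0\<close> the list
  \<open>[0]\<close> contributes 1 to each.\<close>

lemma sum_beta_V:
  assumes "pointed_partition n (L, m)"
  shows "(\<Sum>c\<in>V n L m. beta c) = card {p. p permutes {1..n} \<and> descent_composition n p \<in> V n L m}"
proof (cases "m = 0")
  case False
  let ?P = "\<lambda>c. {p. p permutes {1..n} \<and> descent_composition n p = c}"
  have beta: "beta c = card (?P c)" if c: "c \<in> V n L m" for c
  proof -
    from c obtain cs where cs: "c = cs @ [m]" "0 \<notin> set cs" "sum_list cs + m = n" by (rule mem_V_E)
    have "descents n p = partial_sums c \<longleftrightarrow> descent_composition n p = c" for p
    proof -
      obtain cs' where cs': "descent_composition n p = cs' @ [n - sum_list cs']"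
        "prefix_sums cs' = descents n p" "0 \<notin> set cs'" "sum_list cs' \<le> n" by (rule descent_compositionE)
      have "descents n p = partial_sums c \<longleftrightarrow> cs' = cs"
        unfolding cs(1) partial_sums_snoc using cs'(2) prefix_sums_inj[OF cs'(3) cs(2)] by auto
      thus ?thesis using cs cs' by auto
    qed
    thus ?thesis using False cs by (simp add: beta_def)
  qed
  have "{p. p permutes {1..n} \<and> descent_composition n p \<in> V n L m} = (\<Union>c\<in>V n L m. ?P c)" by auto
  moreover have "card (\<Union>c\<in>V n L m. ?P c) = (\<Sum>c\<in>V n L m. card (?P c))"
    by (rule card_UN_disjoint) (auto simp: finite_V finite_permutations)
  ultimately show ?thesis using beta by simp
next
  case m: True
  show ?thesis
  proof (cases "n = 0")
    case False
    have "beta c = 0" if c: "c \<in> V n L m" for c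
    proof -
      from c obtain cs where "c = cs @ [m]" "sum_list cs + m = n" by (rule mem_V_E)
      thus ?thesis using m False by (cases cs) (auto simp: beta_def)
    qed
    moreover have "descent_composition n p \<notin> V n L m" for p
    proof
      assume *: "descent_composition n p \<in> V n L m"
      obtain cs where cs: "descent_composition n p = cs @ [n - sum_list cs]"
        "prefix_sums cs = descents n p" "0 \<notin> set cs" "sum_list cs \<le> n" by (rule descent_compositionE)
      have "sum_list cs = n" using mem_V_E[OF *] cs m by (metis add.right_neutral last_snoc butlast_snoc)
      moreover from this False obtain c ds where "cs = ds @ [c]" by (cases cs rule: rev_cases) auto
      ultimately have "n \<in> prefix_sums cs" by (simp add: prefix_sums_snoc)
      thus False using cs by (simp add: descents_def)
    qed
    ultimately show ?thesis by simp
  next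
    case True
    have L: "L = {#}" using assms True by (cases L) (auto simp: pointed_partition_def)
    have "[0] \<in> V 0 {#} 0"
      by (auto simp: V_def pointed_composition_def pc_type_def I_filter_def pointed_partition_def I_le_def)
    moreover have "c = [0]" if c: "c \<in> V 0 {#} 0" for c
    proof -
      from c obtain cs where "c = cs @ [0]" "0 \<notin> set cs" "sum_list cs + 0 = 0" by (rule mem_V_E)
      thus ?thesis by (cases cs) auto
    qed
    ultimately have V0: "V 0 {#} 0 = {[0]}" by blast
    have dc: "descent_composition 0 p = [0]" for p by (simp add: descent_composition_def descents_def)
    have "{p. p permutes {1..0::nat} \<and> descent_composition 0 p \<in> V 0 {#} 0} = {id}"
      by (auto simp: V0 dc)
    moreover have "beta [0] = 1" by (simp add: beta_def)
    ultimately show ?thesis unfolding True L m V0 by simp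
  qed
qed

context injective_subset_sums
begin

text \<open>The right-hand side is the condition produced by \<open>signed_compositions\<close> for
  the descent set.\<close>

lemma descent_composition_in_V_iff:
  assumes pp: "pointed_partition n (L, m)"
  shows "descent_composition n p \<in> V n L m \<longleftrightarrow>
    distinct_flag (descents n p) L \<and> (\<forall>d\<in>descents n p. d \<le> sum_mset L) \<and>
    (L = {#} \<or> sum_mset L \<in> descents n p)"
proof -
  let ?P = "\<lambda>c. \<exists>\<mu>. \<mu> \<subseteq># L \<and> sum_mset \<mu> = c \<and> (\<forall>e. count \<mu> e \<le> 1)"
  obtain cs where cs: "descent_composition n p = cs @ [n - sum_list cs]"
    "prefix_sums cs = descents n p" "0 \<notin> set cs" "sum_list cs \<le> n" by (rule descent_compositionE)
  have n: "sum_mset L + m = n" using pp by (simp add: pointed_partition_def)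
  have "(\<forall>i<length cs. ?P (cs ! i)) \<longleftrightarrow> (\<forall>c\<in>set cs. ?P c)" by (auto simp: all_set_conv_all_nth)
  moreover have "pointed_composition n (cs @ [n - sum_list cs])"
  proof -
    have "0 < cs ! i" if "i < length cs" for i using cs(3) nth_mem[OF that] by (metis gr0I)
    thus ?thesis using cs(4) by (simp add: pointed_composition_def nth_append)
  qed
  ultimately have "descent_composition n p \<in> V n L m \<longleftrightarrow>
      (\<exists>\<nu>. \<nu> \<subseteq># L \<and> piece_sums cs \<nu>) \<and> n - sum_list cs = m \<and> (\<forall>c\<in>set cs. ?P c)"
    unfolding cs(1) V_def mem_I_filter_iff[OF pp cs(3,4), symmetric]
    by (simp add: pc_type_def nth_append)
  \<comment> \<open>Last entry \<open>m\<close> means that \<open>cs\<close> and \<open>L\<close>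
    have the same sum, so the flag ends at \<open>L\<close> by injectivity.\<close>
  also have "\<dots> \<longleftrightarrow> piece_sums cs L \<and> (\<forall>c\<in>set cs. ?P c)"
  proof -
    have "n - sum_list cs = m \<longleftrightarrow> \<nu> = L" if "\<nu> \<subseteq># L" "piece_sums cs \<nu>" for \<nu>
      using piece_sums_sum[OF that(2)] sum_eqD[OF that(1)] n cs(4) by auto
    thus ?thesis by (metis subset_mset.order_refl)
  qed
  also have "\<dots> \<longleftrightarrow> distinct_flag (prefix_sums cs) L \<and> (\<forall>d\<in>prefix_sums cs. d \<le> sum_mset L) \<and>
    (L = {#} \<or> sum_mset L \<in> prefix_sums cs)" (is "?l \<longleftrightarrow> ?r")
  proof
    assume l: ?l
    hence "sum_mset L = 0 \<or> sum_mset L \<in> prefix_sums cs" using piece_sums_top by blast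
    hence "L = {#} \<or> sum_mset L \<in> prefix_sums cs" using sum_pos[of L] by force
    thus ?r using l piece_sums_distinct_flag[of cs L] prefix_sums_le[of _ cs] piece_sums_sum[of cs L] by auto
  next
    assume r: ?r
    obtain ds where ds: "piece_sums ds L" "prefix_sums ds = {d\<in>prefix_sums cs. d \<le> sum_mset L}"
      "\<forall>c\<in>set ds. ?P c"
      using distinct_flag_piece_sums[of "prefix_sums cs" L] r prefix_sums_pos[OF cs(3)] by auto
    have "ds = cs" using ds(2) r by (intro prefix_sums_inj[OF piece_sums_pos[OF ds(1)] cs(3)]) auto
    thus ?l using ds by simp
  qed
  finally show ?thesis by (simp add: cs(2))
qed

end

section \<open>Ordered block lists and permutations\<close>

text \<open>The remainder after all segments corresponds to the zero block, hence is sorted as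
  well.\<close>

fun seg_sorted :: "nat list \<Rightarrow> 'a :: linorder list \<Rightarrow> bool" where
  "seg_sorted [] xs = sorted xs"
| "seg_sorted (c # cs) xs = (sorted (take c xs) \<and> seg_sorted cs (drop c xs))"

text \<open>\<open>Suc i\<close> counts the entries up to and including the larger one, so it is the
  descent position in counting from 1.\<close>

lemma seg_sorted_iff_descents:
  "seg_sorted cs xs \<longleftrightarrow> (\<forall>i. Suc i < length xs \<longrightarrow> xs ! Suc i < xs ! i \<longrightarrow> Suc i \<in> prefix_sums cs)"
proof (induction cs arbitrary: xs)
  case Nil
  show ?case by (auto simp: sorted_iff_nth_Suc not_less)
next
  case (Cons c cs)
  show ?case (is "?l \<longleftrightarrow> ?r")
  proof
    assume l: ?l
    show ?r
    proof (intro allI impI)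
      fix i assume i: "Suc i < length xs" "xs ! Suc i < xs ! i"
      consider "Suc i < c" | "Suc i = c" | "c \<le> i" by linarith
      thus "Suc i \<in> prefix_sums (c # cs)"
      proof cases
        case 1
        hence "xs ! i \<le> xs ! Suc i" using l i by (auto simp: sorted_iff_nth_Suc)
        thus ?thesis using i by simp
      next
        case 3
        then obtain j where j: "i = c + j" using le_Suc_ex by blast
        have "seg_sorted cs (drop c xs)" using l by simp
        hence "Suc j \<in> prefix_sums cs" using i unfolding Cons.IH j by auto
        thus ?thesis by (auto simp: j image_iff)
      qed simp
    qed
  next
    assume r: ?r
    have "sorted (take c xs)" unfolding sorted_iff_nth_Suc
    proof (intro allI impI)
      fix i assume i: "Suc i < length (take c xs)"
      hence "Suc i \<notin> prefix_sums (c # cs)" by auto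
      hence "\<not> xs ! Suc i < xs ! i" using r i by auto
      thus "take c xs ! i \<le> take c xs ! Suc i" using i by simp
    qed
    moreover have "seg_sorted cs (drop c xs)" unfolding Cons.IH
    proof (intro allI impI)
      fix j assume j: "Suc j < length (drop c xs)" "drop c xs ! Suc j < drop c xs ! j"
      have "Suc (c + j) \<in> prefix_sums (c # cs)" using r[rule_format, of "c + j"] j by auto
      thus "Suc j \<in> prefix_sums cs" by auto
    qed
    ultimately show ?l by simp
  qed
qed

text \<open>An ordered pointed set partition with implicit zero block, the possibly empty rest of
  \<open>U\<close>. Since \<open>sorted_wrt\<close> compares positions, a non-empty block cannot
  occur twice.\<close>

definition block_list :: "'a set \<Rightarrow> 'a set list \<Rightarrow> bool" where
  "block_list U bs \<longleftrightarrow> {} \<notin> set bs \<and> sorted_wrt (\<lambda>A B. A \<inter> B = {}) bs \<and> \<Union>(set bs) \<subseteq> U"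

lemma block_list_Cons:
  "block_list U (b # bs) \<longleftrightarrow> b \<noteq> {} \<and> b \<subseteq> U \<and> block_list (U - b) bs"
  by (auto simp: block_list_def)

lemma block_list_snoc:
  "block_list U (bs @ [b]) \<longleftrightarrow> block_list U bs \<and> b \<noteq> {} \<and> b \<subseteq> U - \<Union>(set bs)"
  by (auto simp: block_list_def sorted_wrt_append)

lemma block_list_distinct: "block_list U bs \<Longrightarrow> distinct bs"
  by (induction bs arbitrary: U) (auto simp: block_list_def)

lemma finite_block_lists: "finite U \<Longrightarrow> finite {bs. block_list U bs}"
proof (rule finite_subset)
  assume U: "finite U"
  show "{bs. block_list U bs} \<subseteq> {bs. set bs \<subseteq> Pow U \<and> length bs \<le> card (Pow U)}"
  proof safe
    fix bs b assume "block_list U bs" "b \<in> set bs" thus "\<And>x. x \<in> b \<Longrightarrow> x \<in> U" by (auto simp: block_list_def)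
  next
    fix bs assume bs: "block_list U bs"
    hence "length bs = card (set bs)" using block_list_distinct distinct_card by metis
    also have "\<dots> \<le> card (Pow U)" using bs U by (intro card_mono) (auto simp: block_list_def)
    finally show "length bs \<le> card (Pow U)" .
  qed
  show "finite {bs. set bs \<subseteq> Pow U \<and> length bs \<le> card (Pow U)}"
    using U by (intro finite_lists_length_le) simp
qed

lemma block_list_sum_card:
  "finite U \<Longrightarrow> block_list U bs \<Longrightarrow> sum_list (map card bs) = card (\<Union>(set bs))"
proof (induction bs arbitrary: U)
  case (Cons b bs)
  have "b \<subseteq> U" and bl: "block_list (U - b) bs" using Cons.prems by (auto simp: block_list_Cons)
  moreover from bl have "\<Union>(set bs) \<subseteq> U - b" by (simp add: block_list_def)
  ultimately have "card (b \<union> \<Union>(set bs)) = card b + card (\<Union>(set bs))"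
    using Cons.prems(1) by (intro card_Un_disjoint) (auto intro: finite_subset)
  thus ?case using Cons.IH[OF _ bl] Cons.prems(1) by simp
qed simp

text \<open>Writing each block in increasing order, followed by the sorted rest of \<open>U\<close>,
  turns a block list into a word. In the induction both sides split according to the first
  block.\<close>

lemma card_block_lists_eq_seg_sorted:
  fixes U :: "'a :: linorder set"
  assumes "finite U" "0 \<notin> set cs" "sum_list cs \<le> card U"
  shows "card {bs. block_list U bs \<and> map card bs = cs}
       = card {xs. distinct xs \<and> set xs = U \<and> seg_sorted cs xs}"
  using assms
proof (induction cs arbitrary: U)
  case (Nil U)
  have "{bs. block_list U bs \<and> map card bs = []} = {[]}" by (auto simp: block_list_def)
  moreover have "{xs. distinct xs \<and> set xs = U \<and> seg_sorted [] xs} = {sorted_list_of_set U}"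
    using Nil.prems(1) by (auto simp: sorted_list_of_set.idem_if_sorted_distinct)
  ultimately show ?case by simp
next
  case (Cons c cs U)
  define S where "S = {b. b \<subseteq> U \<and> card b = c}"
  let ?B = "\<lambda>U cs. {bs :: 'a set list. block_list U bs \<and> map card bs = cs}"
  let ?X = "\<lambda>U cs. {xs :: 'a list. distinct xs \<and> set xs = U \<and> seg_sorted cs xs}"
  have finS: "finite S" using Cons.prems(1) by (simp add: S_def)
  have c0: "0 < c" using Cons.prems(2) by simp
  have finb: "finite b" if "b \<in> S" for b using that Cons.prems(1) by (auto simp: S_def intro: finite_subset)
  have finB: "finite (?B W cs)" if "finite W" for W :: "'a set"
    by (rule finite_subset[OF _ finite_block_lists[OF that]]) auto
  have finX: "finite (?X W cs)" if "finite W" for W :: "'a set"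
    by (rule finite_subset[OF _ finite_lists_length_le[OF that, of "card W"]]) (auto simp: distinct_card)
  have "?B U (c # cs) = (\<Union>b\<in>S. (#) b ` ?B (U - b) cs)"
  proof (intro equalityI subsetI)
    fix bs assume "bs \<in> ?B U (c # cs)"
    thus "bs \<in> (\<Union>b\<in>S. (#) b ` ?B (U - b) cs)" by (cases bs) (auto simp: block_list_Cons S_def)
  next
    fix bs assume "bs \<in> (\<Union>b\<in>S. (#) b ` ?B (U - b) cs)"
    thus "bs \<in> ?B U (c # cs)" using c0 by (auto simp: block_list_Cons S_def)
  qed
  moreover have "card (\<Union>b\<in>S. (#) b ` ?B (U - b) cs) = (\<Sum>b\<in>S. card ((#) b ` ?B (U - b) cs))"
    by (rule card_UN_disjoint) (use finS Cons.prems(1) in \<open>auto intro!: finB\<close>)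
  ultimately have 1: "card (?B U (c # cs)) = (\<Sum>b\<in>S. card (?B (U - b) cs))"
    by (simp add: card_image)
  have "?X U (c # cs) = (\<Union>b\<in>S. (@) (sorted_list_of_set b) ` ?X (U - b) cs)"
  proof (intro equalityI subsetI)
    fix xs assume xs: "xs \<in> ?X U (c # cs)"
    define b where "b = set (take c xs)"
    have "length xs = card U" using xs distinct_card[of xs] by simp
    hence "length (take c xs) = c" using Cons.prems(3) by simp
    hence "card b = c" unfolding b_def using xs distinct_card[of "take c xs"] by simp
    moreover have "b \<subseteq> U" using xs set_take_subset[of c xs] by (simp add: b_def)
    ultimately have "b \<in> S" by (simp add: S_def)
    moreover have "sorted_list_of_set b = take c xs" unfolding b_def
      by (rule sorted_list_of_set.idem_if_sorted_distinct) (use xs in auto)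
    moreover have "set (drop c xs) = U - b"
    proof -
      have "distinct (take c xs @ drop c xs)" "set (take c xs @ drop c xs) = U"
        using xs by (simp_all only: append_take_drop_id mem_Collect_eq)
      thus ?thesis unfolding b_def distinct_append set_append by blast
    qed
    hence "drop c xs \<in> ?X (U - b) cs" using xs by simp
    ultimately show "xs \<in> (\<Union>b\<in>S. (@) (sorted_list_of_set b) ` ?X (U - b) cs)"
      by (intro UN_I[of b] image_eqI[of _ _ "drop c xs"]) auto
  next
    fix xs assume "xs \<in> (\<Union>b\<in>S. (@) (sorted_list_of_set b) ` ?X (U - b) cs)"
    then obtain b ys where b: "b \<in> S" "ys \<in> ?X (U - b) cs" "xs = sorted_list_of_set b @ ys" by blast
    have "card b = c" "b \<subseteq> U" using b(1) by (auto simp: S_def)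
    thus "xs \<in> ?X U (c # cs)" using b(2,3) finb[OF b(1)] by auto
  qed
  moreover have "card (\<Union>b\<in>S. (@) (sorted_list_of_set b) ` ?X (U - b) cs)
      = (\<Sum>b\<in>S. card ((@) (sorted_list_of_set b) ` ?X (U - b) cs))"
  proof (rule card_UN_disjoint)
    show "\<forall>b\<in>S. finite ((@) (sorted_list_of_set b) ` ?X (U - b) cs)"
      using Cons.prems(1) by (auto intro!: finX)
    show "\<forall>b\<in>S. \<forall>b'\<in>S. b \<noteq> b' \<longrightarrow>
        (@) (sorted_list_of_set b) ` ?X (U - b) cs \<inter> (@) (sorted_list_of_set b') ` ?X (U - b') cs = {}"
    proof (intro ballI impI, rule ccontr)
      fix b b' assume b: "b \<in> S" "b' \<in> S" "b \<noteq> b'" and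
        "(@) (sorted_list_of_set b) ` ?X (U - b) cs \<inter> (@) (sorted_list_of_set b') ` ?X (U - b') cs \<noteq> {}"
      then obtain xs ys where "sorted_list_of_set b @ xs = sorted_list_of_set b' @ ys" by blast
      \<comment> \<open>Blocks of equal size make the cut point of the two words the same.\<close>
      moreover have "length (sorted_list_of_set b) = length (sorted_list_of_set b')"
        using b by (simp add: S_def)
      ultimately have "sorted_list_of_set b = sorted_list_of_set b'" by simp
      thus False using b finb by (metis sorted_list_of_set_inject)
    qed
  qed (rule finS)
  ultimately have 2: "card (?X U (c # cs)) = (\<Sum>b\<in>S. card (?X (U - b) cs))"
    by (simp add: card_image inj_on_def)
  have "card (?B (U - b) cs) = card (?X (U - b) cs)" if b: "b \<in> S" for b
  proof (rule Cons.IH)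
    show "sum_list cs \<le> card (U - b)"
      using b Cons.prems finb[OF b] by (simp add: S_def card_Diff_subset)
  qed (use Cons.prems in auto)
  thus ?case unfolding 1 2 by (rule sum.cong[OF refl])
qed

section \<open>Permutations in one-line notation and their descents\<close>

lemma bij_betw_permutes_lists:
  "bij_betw (\<lambda>p. map p [1..<Suc n]) {p. p permutes {1..n}} {xs. distinct xs \<and> set xs = {1..n}}"
  unfolding bij_betw_def
proof (intro conjI equalityI subsetI)
  show "inj_on (\<lambda>p. map p [1..<Suc n]) {p. p permutes {1..n}}"
  proof (rule inj_onI, rule ext)
    fix p q i assume *: "p \<in> {p. p permutes {1..n}}" "q \<in> {p. p permutes {1..n}}"
      "map p [1..<Suc n] = map q [1..<Suc n]"
    show "p i = q i"
    proof (cases "i \<in> {1..n}")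
      case True
      hence "i \<in> set [1..<Suc n]" by auto
      thus ?thesis using *(3) unfolding map_eq_conv by blast
    next
      case False
      thus ?thesis using *(1,2) by (metis mem_Collect_eq permutes_not_in)
    qed
  qed
next
  fix xs assume "xs \<in> (\<lambda>p. map p [1..<Suc n]) ` {p. p permutes {1..n}}"
  then obtain p where p: "p permutes {1..n}" "xs = map p [1..<Suc n]" by auto
  have "set [1..<Suc n] = {1..n}" by auto
  thus "xs \<in> {xs. distinct xs \<and> set xs = {1..n}}"
    using p permutes_image[OF p(1)] permutes_inj_on[OF p(1), of "{1..n}"] by (simp add: distinct_map)
next
  fix xs assume xs: "xs \<in> {xs. distinct xs \<and> set xs = {1..n}}"
  hence len: "length xs = n" using distinct_card[of xs] by simp
  define p where "p i = (if i \<in> {1..n} then xs ! (i - 1) else i)" for i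
  have map: "map p [1..<Suc n] = xs" by (rule nth_equalityI) (auto simp: len p_def simp del: upt_Suc)
  have s: "set [1..<Suc n] = {1..n}" by auto
  have "p permutes {1..n}"
  proof (rule bij_imp_permutes)
    have "distinct (map p [1..<Suc n])" "set (map p [1..<Suc n]) = {1..n}" using xs unfolding map by auto
    thus "bij_betw p {1..n} {1..n}" unfolding bij_betw_def distinct_map set_map s by blast
  qed (simp only: p_def if_False)
  thus "xs \<in> (\<lambda>p. map p [1..<Suc n]) ` {p. p permutes {1..n}}" using map by (metis image_eqI mem_Collect_eq)
qed

lemma card_block_lists:
  assumes "0 \<notin> set cs" "sum_list cs \<le> n"
  shows "card {bs. block_list {1..n} bs \<and> map card bs = cs}
       = card {p. p permutes {1..n} \<and> descents n p \<subseteq> prefix_sums cs}"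
proof -
  have iff: "seg_sorted cs (map p [1..<Suc n]) \<longleftrightarrow> descents n p \<subseteq> prefix_sums cs" for p
  proof -
    have "seg_sorted cs (map p [1..<Suc n]) \<longleftrightarrow>
        (\<forall>i. Suc i < n \<longrightarrow> p (Suc (Suc i)) < p (Suc i) \<longrightarrow> Suc i \<in> prefix_sums cs)"
      unfolding seg_sorted_iff_descents by (auto simp del: upt_Suc)
    also have "\<dots> \<longleftrightarrow> (\<forall>j. j \<in> descents n p \<longrightarrow> j \<in> prefix_sums cs)"
    proof (intro iffI allI impI)
      fix j assume *: "\<forall>i. Suc i < n \<longrightarrow> p (Suc (Suc i)) < p (Suc i) \<longrightarrow> Suc i \<in> prefix_sums cs"
        "j \<in> descents n p"
      thus "j \<in> prefix_sums cs" by (cases j) (auto simp: descents_def)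
    qed (auto simp: descents_def)
    finally show ?thesis by blast
  qed
  have "card {p. p permutes {1..n} \<and> descents n p \<subseteq> prefix_sums cs}
      = card ((\<lambda>p. map p [1..<Suc n]) ` {p. p permutes {1..n} \<and> descents n p \<subseteq> prefix_sums cs})"
    using bij_betw_permutes_lists[of n]
    by (intro card_image[symmetric]) (auto simp: bij_betw_def intro: inj_on_subset simp del: upt_Suc)
  also have "(\<lambda>p. map p [1..<Suc n]) ` {p. p permutes {1..n} \<and> descents n p \<subseteq> prefix_sums cs}
      = {xs. distinct xs \<and> set xs = {1..n} \<and> seg_sorted cs xs}"
  proof -
    let ?f = "\<lambda>p. map p [1..<Suc n]"
    have "f ` {p \<in> A. R (f p)} = {xs \<in> f ` A. R xs}" for f :: "(nat \<Rightarrow> nat) \<Rightarrow> nat list" and A R by blast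
    from this[of ?f "{p. p permutes {1..n}}" "seg_sorted cs"]
    have "?f ` {p \<in> {p. p permutes {1..n}}. seg_sorted cs (?f p)} = {xs \<in> ?f ` {p. p permutes {1..n}}. seg_sorted cs xs}" .
    thus ?thesis unfolding bij_betw_imp_surj_on[OF bij_betw_permutes_lists] iff
      by (simp only: mem_Collect_eq conj_assoc)
  qed
  finally show ?thesis using card_block_lists_eq_seg_sorted[of "{1..n}" cs] assms by simp
qed

section \<open>Moebius functions and pointed set partitions\<close>

text \<open>The recursion descends from \<open>y\<close> to elements with strictly fewer elements
  below them, so any fuel exceeding the number of elements below \<open>y\<close> gives the same
  value.\<close>

lemma mob_fuel_stable:
  assumes "finite P"
    and tr: "\<And>u v w. u \<in> P \<Longrightarrow> v \<in> P \<Longrightarrow> w \<in> P \<Longrightarrow> le u v \<Longrightarrow> le v w \<Longrightarrow> le u w"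
    and as: "\<And>u v. u \<in> P \<Longrightarrow> v \<in> P \<Longrightarrow> le u v \<Longrightarrow> le v u \<Longrightarrow> u = v"
  shows "y \<in> P \<Longrightarrow> card {z\<in>P. le z y \<and> z \<noteq> y} < k \<Longrightarrow> card {z\<in>P. le z y \<and> z \<noteq> y} < k' \<Longrightarrow>
    mob_fuel le P k x y = mob_fuel le P k' x y"
proof (induction k arbitrary: y k')
  case (Suc k)
  then obtain k'' where k': "k' = Suc k''" by (cases k') auto
  have "mob_fuel le P k x z = mob_fuel le P k'' x z" if z: "z \<in> P" "le z y" "z \<noteq> y" for z
  proof (rule Suc.IH[OF z(1)])
    have "{w\<in>P. le w z \<and> w \<noteq> z} \<subset> {w\<in>P. le w y \<and> w \<noteq> y}"
      using z Suc.prems(1) tr[OF _ z(1) Suc.prems(1)] as[OF z(1) Suc.prems(1)] by blast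
    hence "card {w\<in>P. le w z \<and> w \<noteq> z} < card {w\<in>P. le w y \<and> w \<noteq> y}"
      using assms(1) by (intro psubset_card_mono) auto
    thus "card {w\<in>P. le w z \<and> w \<noteq> z} < k" "card {w\<in>P. le w z \<and> w \<noteq> z} < k''"
      using Suc.prems k' by auto
  qed
  hence "(\<Sum>z\<in>{z\<in>P. le x z \<and> le z y \<and> z \<noteq> y}. mob_fuel le P k x z) =
      (\<Sum>z\<in>{z\<in>P. le x z \<and> le z y \<and> z \<noteq> y}. mob_fuel le P k'' x z)"
    by (intro sum.cong) auto
  thus ?case unfolding k' by simp
qed simp

lemma mobius_rec:
  assumes "finite P"
    and tr: "\<And>u v w. u \<in> P \<Longrightarrow> v \<in> P \<Longrightarrow> w \<in> P \<Longrightarrow> le u v \<Longrightarrow> le v w \<Longrightarrow> le u w"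
    and as: "\<And>u v. u \<in> P \<Longrightarrow> v \<in> P \<Longrightarrow> le u v \<Longrightarrow> le v u \<Longrightarrow> u = v"
    and "y \<in> P" "x \<noteq> y" "le x y"
  shows "mobius le P x y = - (\<Sum>z\<in>{z\<in>P. le x z \<and> le z y \<and> z \<noteq> y}. mobius le P x z)"
proof -
  \<comment> \<open>One unfolding leaves fuel \<open>card P\<close>, still enough since
    \<open>z\<close> is not counted among the elements strictly below it.\<close>
  have "mob_fuel le P (card P) x z = mobius le P x z" if "z \<in> P" for z
    unfolding mobius_def
  proof (rule mob_fuel_stable[OF assms(1) tr as that])
    show *: "card {w\<in>P. le w z \<and> w \<noteq> z} < card P"
      using that assms(1) by (intro psubset_card_mono) auto
    thus "card {w\<in>P. le w z \<and> w \<noteq> z} < card P + 1" by simp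
  qed
  hence "(\<Sum>z\<in>{z\<in>P. le x z \<and> le z y \<and> z \<noteq> y}. mob_fuel le P (card P) x z) =
      (\<Sum>z\<in>{z\<in>P. le x z \<and> le z y \<and> z \<noteq> y}. mobius le P x z)"
    by (intro sum.cong) auto
  thus ?thesis using assms(5,6) by (simp add: mobius_def[of le P x y])
qed

lemma mobius_refl: "mobius le P x x = 1"
  by (simp add: mobius_def)

section \<open>The poset of pointed set partitions and its adjoined bottom\<close>

lemma ps_le_trans: "ps_le p q \<Longrightarrow> ps_le q r \<Longrightarrow> ps_le p r"
  unfolding ps_le_def by (meson subset_trans)

text \<open>The zero blocks agree and other blocks are non-empty and avoid them, so
  \<open>B \<subseteq> B' \<subseteq> B''\<close> with \<open>B\<close> and \<open>B''\<close> both
  in \<open>fst p\<close>; disjointness forces equality.\<close>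

lemma ps_le_antisym_aux:
  assumes "p \<in> pointed_set_partitions n" "q \<in> pointed_set_partitions n" "ps_le p q" "ps_le q p"
  shows "fst p \<subseteq> fst q"
proof
  fix B assume B: "B \<in> fst p"
  have Z: "snd p = snd q" using assms by (auto simp: ps_le_def)
  have part: "partition_on ({1..n} - snd p) (fst p)" "partition_on ({1..n} - snd q) (fst q)"
    using assms by (auto simp: pointed_set_partitions_def)
  have "B \<noteq> {}" "B \<inter> snd q = {}" using part(1) B Z by (auto simp: partition_on_def)
  then obtain B' where B': "B' \<in> fst q" "B \<subseteq> B'" using assms(3) B unfolding ps_le_def by blast
  have "B' \<noteq> {}" "B' \<inter> snd p = {}" using part(2) B' Z by (auto simp: partition_on_def)
  then obtain B'' where B'': "B'' \<in> fst p" "B' \<subseteq> B''" using assms(4) B' unfolding ps_le_def by blast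
  have "B \<inter> B'' \<noteq> {}" using B'(2) B''(2) \<open>B \<noteq> {}\<close> by blast
  hence "B = B''" using partition_onD2[OF part(1)] B B''(1) unfolding disjoint_def by blast
  thus "B \<in> fst q" using B' B'' by auto
qed

lemma ps_le_antisym:
  assumes "p \<in> pointed_set_partitions n" "q \<in> pointed_set_partitions n" "ps_le p q" "ps_le q p"
  shows "p = q"
  using ps_le_antisym_aux[OF assms] ps_le_antisym_aux[OF assms(2,1,4,3)] assms
  by (auto simp: ps_le_def prod_eq_iff)

lemma finite_pointed_set_partitions: "finite (pointed_set_partitions n)"
proof (rule finite_subset)
  show "pointed_set_partitions n \<subseteq> Pow (Pow {1..n}) \<times> Pow {1..n}"
    by (auto simp: pointed_set_partitions_def partition_on_def)
qed simp

text \<open>Here \<open>g z\<close> plays the role of \<open>\<mu>(z, t)\<close>; sum \<open>\<mu>(None, x) * g z\<close> over all \<open>x \<le> z\<close>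
  in two ways.\<close>

lemma mobius_adjoined_bottom:
  assumes Q: "Q \<subseteq> pointed_set_partitions n" and t: "t \<in> Q"
    and g: "\<And>x. x \<in> Q \<Longrightarrow> (\<Sum>z | z \<in> Q \<and> ps_le x z. g z) = (if x = t then 1 else 0 :: int)"
  shows "mobius hat_le (insert None (Some ` Q)) None (Some t) = - (\<Sum>z\<in>Q. g z)"
proof -
  let ?P = "insert None (Some ` Q)"
  define f where "f x = mobius hat_le ?P None (Some x)" for x
  have finQ: "finite Q" using Q finite_pointed_set_partitions by (rule finite_subset)
  \<comment> \<open>The Moebius recursion at \<open>z\<close>, with the value 1 at the bottom moved
    across.\<close>
  have below: "(\<Sum>x | x \<in> Q \<and> ps_le x z. f x) = -1" if z: "z \<in> Q" for z
  proof -
    let ?D = "{x\<in>Q. ps_le x z \<and> x \<noteq> z}"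
    have "f z = - (\<Sum>w\<in>{w\<in>?P. hat_le None w \<and> hat_le w (Some z) \<and> w \<noteq> Some z}. mobius hat_le ?P None w)"
      unfolding f_def
    proof (rule mobius_rec)
      show "finite ?P" using finQ by simp
      show "hat_le u w" if "hat_le u v" "hat_le v w" for u v w
        using that by (auto simp: hat_le_def split: option.splits intro: ps_le_trans)
      show "u = v" if "u \<in> ?P" "v \<in> ?P" "hat_le u v" "hat_le v u" for u v
      proof (cases "u = None \<or> v = None")
        case True thus ?thesis using that by (auto simp: hat_le_def split: option.splits)
      next
        case False
        then obtain a b where ab: "u = Some a" "v = Some b" by auto
        hence "a \<in> Q" "b \<in> Q" "ps_le a b" "ps_le b a" using that by (auto simp: hat_le_def)
        thus ?thesis using Q ps_le_antisym ab by blast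
      qed
    qed (use z in \<open>auto simp: hat_le_def\<close>)
    also have "{w\<in>?P. hat_le None w \<and> hat_le w (Some z) \<and> w \<noteq> Some z} = insert None (Some ` ?D)"
      by (auto simp: hat_le_def)
    also have "(\<Sum>w\<in>insert None (Some ` ?D). mobius hat_le ?P None w) = 1 + (\<Sum>x\<in>?D. f x)"
      using finQ by (subst sum.insert) (auto simp: mobius_refl sum.reindex f_def)
    finally have "f z + (\<Sum>x\<in>?D. f x) = -1" by simp
    moreover have "{x. x \<in> Q \<and> ps_le x z} = insert z ?D" using z by (auto simp: ps_le_def)
    ultimately show ?thesis using finQ by simp
  qed
  have "- (\<Sum>z\<in>Q. g z) = (\<Sum>z\<in>Q. (\<Sum>x | x \<in> Q \<and> ps_le x z. f x) * g z)"
    by (simp add: below sum_negf)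
  also have "\<dots> = (\<Sum>z\<in>Q. \<Sum>x | x \<in> Q \<and> ps_le x z. f x * g z)" by (simp add: sum_distrib_right)
  also have "\<dots> = (\<Sum>x\<in>Q. \<Sum>z | z \<in> Q \<and> ps_le x z. f x * g z)"
    by (rule sum.swap_restrict[OF finQ finQ])
  also have "\<dots> = (\<Sum>x\<in>Q. f x * (if x = t then 1 else 0))"
    by (simp add: g flip: sum_distrib_left)
  also have "\<dots> = f t" using finQ t by (simp add: if_distrib cong: if_cong)
  finally show ?thesis by (simp add: f_def)
qed

section \<open>Pointed set partitions presented by ordered lists of blocks\<close>

definition ps_of_blocks :: "nat \<Rightarrow> nat set list \<Rightarrow> pspart" where
  "ps_of_blocks n bs = (set bs, {1..n} - \<Union>(set bs))"

lemma block_list_disjoint: "block_list U bs \<Longrightarrow> disjoint (set bs)"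
proof (induction bs arbitrary: U)
  case (Cons b bs)
  hence "disjoint (set bs)" "\<Union>(set bs) \<inter> b = {}" by (auto simp: block_list_Cons block_list_def)
  thus ?case by (auto simp: disjoint_def)
qed simp

lemma ps_of_blocks_mem:
  assumes "block_list {1..n} bs"
  shows "ps_of_blocks n bs \<in> pointed_set_partitions n"
  using assms block_list_disjoint[OF assms]
  by (auto simp: ps_of_blocks_def pointed_set_partitions_def partition_on_def block_list_def)

lemma ps_type_ps_of_blocks:
  assumes "block_list {1..n} bs"
  shows "ps_type (ps_of_blocks n bs) = (mset (map card bs), n - sum_list (map card bs))"
proof -
  have "mset_set (set bs) = mset bs" using block_list_distinct[OF assms] by (rule mset_set_set)
  moreover have "\<Union>(set bs) \<subseteq> {1..n}" using assms by (simp add: block_list_def)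
  hence "card ({1..n} - \<Union>(set bs)) = n - card (\<Union>(set bs))"
    by (subst card_Diff_subset) (auto intro: finite_subset)
  ultimately show ?thesis using block_list_sum_card[OF _ assms] by (simp add: ps_type_def ps_of_blocks_def)
qed

lemma sum_card_block_list_le: "block_list {1..n} bs \<Longrightarrow> sum_list (map card bs) \<le> n"
  using block_list_sum_card[of "{1..n}" bs] card_mono[of "{1..n}" "\<Union>(set bs)"]
  by (simp add: block_list_def)

lemma card_block_list_pos: "block_list {1..n::nat} bs \<Longrightarrow> 0 \<notin> set (map card bs)"
  by (auto simp: block_list_def) (metis Sup_le_iff card_eq_0_iff finite_atLeastAtMost finite_subset)

text \<open>The flag is read off along \<open>bs\<close>: each list block contributes the sizes of
  the blocks of \<sigma> inside it, and these add up to its own size.\<close>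

lemma block_list_piece_sums:
  fixes \<sigma> :: "nat set set"
  assumes \<sigma>: "partition_on U \<sigma>" and U: "finite U"
  shows "block_list U bs \<Longrightarrow> (\<forall>B\<in>\<sigma>. (\<exists>b\<in>set bs. B \<subseteq> b) \<or> B \<inter> \<Union>(set bs) = {}) \<Longrightarrow>
    piece_sums (map card bs) (image_mset card (mset_set {B\<in>\<sigma>. B \<subseteq> \<Union>(set bs)}))"
proof (induction bs rule: rev_induct)
  case Nil
  have e: "{B\<in>\<sigma>. B \<subseteq> \<Union>(set [])} = {}" using \<sigma> by (auto simp: partition_on_def)
  show ?case unfolding e by (simp add: piece_sums_Nil)
next
  case (snoc b bs)
  have fin: "finite \<sigma>" using \<sigma> U by (rule finite_elements[rotated])
  have bl: "block_list U bs" and b: "b \<noteq> {}" "b \<subseteq> U" "b \<inter> \<Union>(set bs) = {}"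
    using snoc.prems(1) by (auto simp: block_list_snoc)
  have ne: "B \<noteq> {}" if "B \<in> \<sigma>" for B using that \<sigma> by (auto simp: partition_on_def)
  let ?S = "{B\<in>\<sigma>. B \<subseteq> b}"
  let ?\<delta> = "image_mset card (mset_set ?S)"
  \<comment> \<open>The \<sigma>-block of a point of \<open>b\<close> meets the list, so it lies in
    some list block; disjointness leaves only \<open>b\<close>.\<close>
  have "b = \<Union>?S"
  proof (intro equalityI subsetI)
    fix y assume y: "y \<in> b"
    then obtain B where B: "B \<in> \<sigma>" "y \<in> B" using b(2) \<sigma> by (auto simp: partition_on_def)
    hence "\<not> B \<inter> \<Union>(set (bs @ [b])) = {}" using y by auto
    then obtain b' where b': "b' \<in> set (bs @ [b])" "B \<subseteq> b'" using snoc.prems(2) B by blast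
    have "b' = b" using b' b(3) y B by auto
    thus "y \<in> \<Union>?S" using b' B by auto
  qed auto
  moreover have "card (\<Union>?S) = sum card ?S"
  proof (rule card_Union_disjoint)
    show "pairwise disjnt ?S" using \<sigma> by (auto simp: partition_on_def disjoint_def pairwise_def disjnt_def)
    show "finite B" if "B \<in> ?S" for B using that b(2) U by (auto intro: finite_subset)
  qed
  ultimately have \<delta>: "sum_mset ?\<delta> = card b" by (simp add: sum_unfold_sum_mset)
  have "0 < card b" using b U by (metis card_gt_0_iff finite_subset)
  moreover have "\<forall>B\<in>\<sigma>. (\<exists>b\<in>set bs. B \<subseteq> b) \<or> B \<inter> \<Union>(set bs) = {}"
    using snoc.prems(2) b(3) by fastforce
  note IH = snoc.IH[OF bl this]
  ultimately have "piece_sums (map card bs @ [sum_mset ?\<delta>])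
      (image_mset card (mset_set {B\<in>\<sigma>. B \<subseteq> \<Union>(set bs)}) + ?\<delta>)"
    using \<delta> by (intro piece_sums_snoc) simp_all
  moreover have "{B\<in>\<sigma>. B \<subseteq> \<Union>(set (bs @ [b]))} = {B\<in>\<sigma>. B \<subseteq> \<Union>(set bs)} \<union> ?S"
  proof (intro equalityI subsetI)
    fix B assume "B \<in> {B\<in>\<sigma>. B \<subseteq> \<Union>(set (bs @ [b]))}"
    hence B: "B \<in> \<sigma>" "B \<subseteq> \<Union>(set (bs @ [b]))" by auto
    hence "B \<inter> \<Union>(set (bs @ [b])) \<noteq> {}" using ne by blast
    then obtain b' where "b' \<in> set (bs @ [b])" "B \<subseteq> b'" using snoc.prems(2) B(1) by blast
    thus "B \<in> {B\<in>\<sigma>. B \<subseteq> \<Union>(set bs)} \<union> ?S" using B(1) by auto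
  qed auto
  moreover have "{B\<in>\<sigma>. B \<subseteq> \<Union>(set bs)} \<inter> ?S = {}" using ne b(3) by blast
  ultimately show ?case using fin \<delta> by (simp add: mset_set_Union)
qed

text \<open>Removing the zero block of \<open>x\<close> from the ground set turns lying in the zero
  block of the list into missing all list blocks, the form needed for flags and for the
  involution.\<close>

lemma ps_le_ps_of_blocks_iff:
  assumes x: "x \<in> pointed_set_partitions n"
  shows "block_list {1..n} bs \<and> ps_le x (ps_of_blocks n bs) \<longleftrightarrow>
    block_list ({1..n} - snd x) bs \<and> (\<forall>B\<in>fst x. (\<exists>b\<in>set bs. B \<subseteq> b) \<or> B \<inter> \<Union>(set bs) = {})"
proof -
  have "B \<subseteq> {1..n} - snd x" if "B \<in> fst x" for B
    using that x by (auto simp: pointed_set_partitions_def partition_on_def)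
  hence "B \<subseteq> {1..n} - \<Union>(set bs) \<longleftrightarrow> B \<inter> \<Union>(set bs) = {}" if "B \<in> fst x" for B
    using that by blast
  hence "(\<forall>B\<in>fst x. (\<exists>b\<in>set bs. B \<subseteq> b) \<or> B \<subseteq> {1..n} - \<Union>(set bs)) \<longleftrightarrow>
      (\<forall>B\<in>fst x. (\<exists>b\<in>set bs. B \<subseteq> b) \<or> B \<inter> \<Union>(set bs) = {})" by (metis (no_types, lifting))
  moreover have "snd x \<subseteq> {1..n}" using x by (auto simp: pointed_set_partitions_def)
  hence "\<Union>(set bs) \<subseteq> {1..n} \<and> snd x \<subseteq> {1..n} - \<Union>(set bs) \<longleftrightarrow> \<Union>(set bs) \<subseteq> {1..n} - snd x" by blast
  ultimately show ?thesis unfolding ps_le_def ps_of_blocks_def block_list_def fst_conv snd_conv by blast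
qed

text \<open>Coarsening adds sizes, so types move up in the integer poset. Hence the signed count of
  the lists above \<open>x\<close> is not truncated by the filter.\<close>

lemma I_filter_up_closed:
  assumes x: "x \<in> pointed_set_partitions n" "ps_type x \<in> I_filter n y"
    and bs: "block_list {1..n} bs" and le: "ps_le x (ps_of_blocks n bs)"
  shows "ps_type (ps_of_blocks n bs) \<in> I_filter n y"
proof -
  have bl: "block_list ({1..n} - snd x) bs"
    and B: "\<forall>B\<in>fst x. (\<exists>b\<in>set bs. B \<subseteq> b) \<or> B \<inter> \<Union>(set bs) = {}"
    using ps_le_ps_of_blocks_iff[OF x(1), of bs] bs le by blast+
  have part: "partition_on ({1..n} - snd x) (fst x)" using x(1) by (auto simp: pointed_set_partitions_def)
  have fin: "finite (fst x)" by (rule finite_elements[OF _ part]) simp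
  obtain N k where N: "ps_type x = (N, k)" by (cases "ps_type x")
  have "image_mset card (mset_set {B\<in>fst x. B \<subseteq> \<Union>(set bs)}) \<subseteq># N"
    using N fin by (auto simp: ps_type_def intro!: image_mset_subseteq_mono subset_imp_msubset_mset_set)
  moreover have "piece_sums (map card bs) (image_mset card (mset_set {B\<in>fst x. B \<subseteq> \<Union>(set bs)}))"
    by (rule block_list_piece_sums[OF part _ bl B]) simp
  moreover have "pointed_partition n (N, k)" "I_le y (N, k)" using x(2) N by (auto simp: I_filter_def)
  \<comment> \<open>Here the filter criterion is applied with the type of \<open>x\<close> as
    generator.\<close>
  ultimately have "ps_type (ps_of_blocks n bs) \<in> I_filter n (N, k)"
    unfolding ps_type_ps_of_blocks[OF bs]
    using mem_I_filter_iff[OF _ card_block_list_pos[OF bs] sum_card_block_list_le[OF bs]] by blast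
  thus ?thesis using \<open>I_le y (N, k)\<close> by (auto simp: I_filter_def intro: I_le_trans)
qed

text \<open>The sign-reversing involution appends or deletes the block that makes the list
  exhaust the complement of the zero block of \<open>x\<close>.\<close>

lemma signed_block_lists_above:
  assumes x: "x \<in> pointed_set_partitions n"
  shows "(\<Sum>bs | block_list {1..n} bs \<and> ps_le x (ps_of_blocks n bs). (-1) ^ length bs)
       = (if x = ({}, {1..n}) then 1 else 0 :: int)"
proof -
  define U where "U = {1..n} - snd x"
  have part: "partition_on U (fst x)" using x by (auto simp: pointed_set_partitions_def U_def)
  define T where "T = {bs. block_list U bs \<and> (\<forall>B\<in>fst x. (\<exists>b\<in>set bs. B \<subseteq> b) \<or> B \<inter> \<Union>(set bs) = {})}"
  have T: "{bs. block_list {1..n} bs \<and> ps_le x (ps_of_blocks n bs)} = T"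
    unfolding T_def U_def using ps_le_ps_of_blocks_iff[OF x] by blast
  show ?thesis
  proof (cases "U = {}")
    case True
    have "snd x \<subseteq> {1..n}" using x by (auto simp: pointed_set_partitions_def)
    hence "x = ({}, {1..n})" using part True unfolding U_def by (auto simp: partition_on_def prod_eq_iff)
    moreover have "T = {[]}"
    proof -
      have "bs = []" if "block_list {} bs" for bs :: "nat set list"
        using that by (cases bs) (auto simp: block_list_Cons)
      moreover have "block_list {} ([] :: nat set list)" by (simp add: block_list_def)
      ultimately show ?thesis unfolding T_def True by auto
    qed
    ultimately show ?thesis unfolding T by simp
  next
    case False
    define t where "t bs = (if \<Union>(set bs) = U then butlast bs else bs @ [U - \<Union>(set bs)])" for bs
    have tT: "t bs \<in> T \<and> t (t bs) = bs \<and> (-1::int) ^ length (t bs) = - ((-1) ^ length bs)"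
      if bs: "bs \<in> T" for bs
    proof (cases "\<Union>(set bs) = U")
      case True
      hence "bs \<noteq> []" using False by auto
      then obtain as b where as: "bs = as @ [b]" by (cases bs rule: rev_cases) auto
      have b: "block_list U as" "b \<noteq> {}" "b \<subseteq> U - \<Union>(set as)"
        using bs by (auto simp: T_def as block_list_snoc)
      have "\<Union>(set as) \<noteq> U" "b = U - \<Union>(set as)" using b True as by auto
      \<comment> \<open>A block of \<open>x\<close> inside the deleted \<open>b\<close> now misses
        all remaining list blocks.\<close>
      moreover have "(\<exists>b'\<in>set as. B \<subseteq> b') \<or> B \<inter> \<Union>(set as) = {}" if "B \<in> fst x" for B
        using bs that b(3) unfolding T_def as by simp blast
      hence "as \<in> T" using b(1) by (simp add: T_def)
      ultimately show ?thesis using True by (simp add: t_def as)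
    next
      case neq: False
      have "\<Union>(set bs) \<subseteq> U" using bs by (auto simp: T_def block_list_def)
      hence "block_list U (bs @ [U - \<Union>(set bs)])" "\<Union>(set (bs @ [U - \<Union>(set bs)])) = U"
        using bs neq by (auto simp: T_def block_list_snoc)
      moreover have "B \<subseteq> U" if "B \<in> fst x" for B using that part by (auto simp: partition_on_def)
      hence "(\<exists>b\<in>set (bs @ [U - \<Union>(set bs)]). B \<subseteq> b)" if "B \<in> fst x" for B
        using bs that by (fastforce simp: T_def)
      ultimately show ?thesis using neq by (auto simp: t_def T_def)
    qed
    have "(\<Sum>bs\<in>T. (-1::int) ^ length bs) = (\<Sum>bs\<in>T. - ((-1) ^ length bs))"
      by (rule sum.reindex_bij_witness[of _ t t]) (use tT in auto)
    hence "(\<Sum>bs\<in>T. (-1::int) ^ length bs) = 0" by (simp add: sum_negf)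
    moreover have "x \<noteq> ({}, {1..n})" using False by (auto simp: U_def)
    ultimately show ?thesis unfolding T by simp
  qed
qed

section \<open>The double count over block lists and permutations\<close>

theorem theorem4p5:
  fixes n m :: nat and L :: "nat multiset"
  assumes "pointed_partition n (L, m)"
    and "knapsack L"
  shows "real_of_int (mu_Pi_F n (I_filter n (L, m)))
           = (-1) powi (int (size L) - 1) * real (\<Sum>c\<in>V n L m. beta c)
       \<and> real_of_int (mu_Pi_F n (I_filter n (L, m)))
           = (-1) powi (int (size L) - 1)
             * real (card {p. p permutes {1..n} \<and> descent_composition n p \<in> V n L m})"
proof -
  interpret injective_subset_sums L
    using assms(2) by unfold_locales (rule knapsack_inj_on)
  define Q where "Q = Pi_F n (I_filter n (L, m))"
  define BL where "BL = {bs. block_list {1..n} bs}"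
  define G where "G = {cs. \<exists>\<nu>. \<nu> \<subseteq># L \<and> piece_sums cs \<nu>}"
  define Pm where "Pm = {p. p permutes {1..n}}"
  \<comment> \<open>The signed number of orderings of the non-zero blocks of \<open>z\<close>;
    \<open>above\<close> shows that it has the defining property of the Moebius value from
    \<open>z\<close> to the top.\<close>
  define g where "g z = (\<Sum>bs | bs \<in> BL \<and> ps_of_blocks n bs = z. (-1::int) ^ length bs)" for z
  define W where "W = {p. p permutes {1..n} \<and> descent_composition n p \<in> V n L m}"
  have finBL: "finite BL" unfolding BL_def by (rule finite_block_lists) simp
  have finPm: "finite Pm" unfolding Pm_def by (rule finite_permutations) simp
  have Qsub: "Q \<subseteq> pointed_set_partitions n" by (auto simp: Q_def Pi_F_def)
  have finQ: "finite Q" using Qsub finite_pointed_set_partitions by (rule finite_subset)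
  have Gpos: "0 \<notin> set cs" "sum_list cs \<le> n" if "cs \<in> G" for cs
  proof -
    obtain \<nu> where \<nu>: "\<nu> \<subseteq># L" "piece_sums cs \<nu>" using \<open>cs \<in> G\<close> by (auto simp: G_def)
    show "0 \<notin> set cs" using \<nu>(2) by (rule piece_sums_pos)
    show "sum_list cs \<le> n" using sum_mset_subset_mono[OF \<nu>(1)] piece_sums_sum[OF \<nu>(2)] assms(1)
      by (simp add: pointed_partition_def)
  qed
  have finG: "finite G"
    by (rule finite_subset[OF _ finite_pos_lists[of n]]) (use Gpos in auto)
  have Q_iff: "ps_of_blocks n bs \<in> Q \<longleftrightarrow> map card bs \<in> G" if "bs \<in> BL" for bs
  proof -
    have bs: "block_list {1..n} bs" using that by (simp add: BL_def)
    show ?thesis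
      unfolding Q_def Pi_F_def G_def mem_Collect_eq ps_type_ps_of_blocks[OF bs]
        mem_I_filter_iff[OF assms(1) card_block_list_pos[OF bs] sum_card_block_list_le[OF bs]]
      using ps_of_blocks_mem[OF bs] by blast
  qed
  have topeq: "ps_of_blocks n [] = ({}, {1..n})" by (simp add: ps_of_blocks_def)
  have "[] \<in> BL" by (simp add: BL_def block_list_def)
  moreover have "[] \<in> G" unfolding G_def using piece_sums_Nil subset_mset.zero_le by blast
  ultimately have top: "({}, {1..n}) \<in> Q" using Q_iff[of "[]"] unfolding topeq by simp
  have above: "(\<Sum>z | z \<in> Q \<and> ps_le x z. g z) = (if x = ({}, {1..n}) then 1 else 0)" if x: "x \<in> Q" for x
  proof -
    let ?S = "{bs. block_list {1..n} bs \<and> ps_le x (ps_of_blocks n bs)}"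
    let ?T = "{z. z \<in> Q \<and> ps_le x z}"
    have xp: "x \<in> pointed_set_partitions n" "ps_type x \<in> I_filter n (L, m)"
      using x by (auto simp: Q_def Pi_F_def)
    have sub: "ps_of_blocks n ` ?S \<subseteq> ?T"
      using I_filter_up_closed[OF xp] ps_of_blocks_mem by (auto simp: Q_def Pi_F_def)
    have finS: "finite ?S" by (rule finite_subset[OF _ finBL]) (auto simp: BL_def)
    have "(\<Sum>z\<in>?T. g z) = (\<Sum>z\<in>?T. \<Sum>bs\<in>{bs\<in>?S. ps_of_blocks n bs = z}. (-1) ^ length bs)"
      unfolding g_def by (intro sum.cong) (auto simp: BL_def)
    also have "\<dots> = (\<Sum>bs\<in>?S. (-1) ^ length bs)"
      by (rule sum.group[OF finS _ sub]) (use finQ in simp)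
    finally show ?thesis using signed_block_lists_above[OF xp(1)] by simp
  qed
  have "mu_Pi_F n (I_filter n (L, m)) = - (\<Sum>z\<in>Q. g z)"
    unfolding mu_Pi_F_def Q_def[symmetric] by (rule mobius_adjoined_bottom[OF Qsub top above])
  also have "(\<Sum>z\<in>Q. g z) = (\<Sum>bs\<in>{bs\<in>BL. ps_of_blocks n bs \<in> Q}. (-1) ^ length bs)"
  proof -
    have "(\<Sum>z\<in>Q. g z) = (\<Sum>z\<in>Q. \<Sum>bs\<in>{bs\<in>{bs\<in>BL. ps_of_blocks n bs \<in> Q}. ps_of_blocks n bs = z}. (-1) ^ length bs)"
      unfolding g_def by (intro sum.cong) auto
    also have "\<dots> = (\<Sum>bs\<in>{bs\<in>BL. ps_of_blocks n bs \<in> Q}. (-1) ^ length bs)"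
      by (rule sum.group) (use finBL finQ in auto)
    finally show ?thesis .
  qed
  also have "{bs\<in>BL. ps_of_blocks n bs \<in> Q} = {bs\<in>BL. map card bs \<in> G}" using Q_iff by auto
  also have "(\<Sum>bs\<in>{bs\<in>BL. map card bs \<in> G}. (-1::int) ^ length bs) =
      (\<Sum>cs\<in>G. \<Sum>bs\<in>{bs\<in>{bs\<in>BL. map card bs \<in> G}. map card bs = cs}. (-1) ^ length bs)"
    by (rule sum.group[symmetric]) (use finBL finG in auto)
  \<comment> \<open>For fixed sizes the sign is constant, so lists may be traded for equally many
    permutations.\<close>
  also have "\<dots> = (\<Sum>cs\<in>G. \<Sum>p | p \<in> Pm \<and> descents n p \<subseteq> prefix_sums cs. (-1) ^ length cs)"
  proof (rule sum.cong[OF refl])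
    fix cs assume cs: "cs \<in> G"
    have "(\<Sum>bs\<in>{bs\<in>{bs\<in>BL. map card bs \<in> G}. map card bs = cs}. (-1::int) ^ length bs) =
        (\<Sum>bs | block_list {1..n} bs \<and> map card bs = cs. (-1) ^ length cs)"
      using cs by (intro sum.cong) (auto simp: BL_def)
    also have "\<dots> = (\<Sum>p | p \<in> Pm \<and> descents n p \<subseteq> prefix_sums cs. (-1) ^ length cs)"
      using card_block_lists[OF Gpos[OF cs]] by (simp add: Pm_def)
    finally show "(\<Sum>bs\<in>{bs\<in>{bs\<in>BL. map card bs \<in> G}. map card bs = cs}. (-1::int) ^ length bs) =
        (\<Sum>p | p \<in> Pm \<and> descents n p \<subseteq> prefix_sums cs. (-1) ^ length cs)" .
  qed
  also have "\<dots> = (\<Sum>p\<in>Pm. \<Sum>cs | cs \<in> G \<and> descents n p \<subseteq> prefix_sums cs. (-1) ^ length cs)"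
    by (rule sum.swap_restrict[OF finG finPm])
  also have "\<dots> = (\<Sum>p\<in>Pm. if descent_composition n p \<in> V n L m then (-1) ^ size L else 0)"
  proof (rule sum.cong[OF refl])
    fix p
    have "finite (descents n p)" "0 \<notin> descents n p" by (auto simp: descents_def)
    from signed_compositions[OF this]
    show "(\<Sum>cs | cs \<in> G \<and> descents n p \<subseteq> prefix_sums cs. (-1) ^ length cs) =
        (if descent_composition n p \<in> V n L m then (-1) ^ size L else (0::int))"
      unfolding G_def descent_composition_in_V_iff[OF assms(1)] by simp
  qed
  also have "\<dots> = (\<Sum>p\<in>W. (-1) ^ size L)"
    unfolding W_def Pm_def using finPm
    by (subst sum.inter_filter[symmetric]) (auto simp: Pm_def)
  finally have "mu_Pi_F n (I_filter n (L, m)) = - ((-1) ^ size L * int (card W))" by simp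
  hence "real_of_int (mu_Pi_F n (I_filter n (L, m))) = - ((-1) ^ size L) * real (card W)" by simp
  \<comment> \<open>The exponent is an integer because it is -1 for \<open>L = {#}\<close>.\<close>
  moreover have "(-1::real) powi (int (size L) - 1) = - ((-1) ^ size L)"
    by (simp add: power_int_diff)
  ultimately have "real_of_int (mu_Pi_F n (I_filter n (L, m))) =
      (-1) powi (int (size L) - 1) * real (card W)" by simp
  thus ?thesis unfolding sum_beta_V[OF assms(1)] W_def by blast
qed

end
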